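(* Let $\theta=\mu+\sigma i$ with $\mu\in\mathbb{R}$, $\sigma>0$, let $X_1,X_2,\dots$ be i.i.d. random variables with the Cauchy distribution $P_\theta$, and let $f$ be an admissible generator (see context). Let $Y_n=f^{-1}\left(\frac1n\sum_{j=1}^n f(X_j)\right)$ and let \[ Z_n=Y_n+\frac{2\,\mathrm{Im}(Y_n)\,i}{n}\sum_{j=1}^n\frac{X_j-Y_n}{X_j-\overline{Y_n}} \] be the associated one-step estimator. If there exists a constant $\lambda>0$ such that $E[\exp(\lambda|f(X_1)|)]<+\infty$, then \[ \limsup_{\epsilon\to+0}\ \limsup_{n\to\infty}\frac{\log P\left(|Z_n-\theta|>\epsilon\right)}{n\,b(\epsilon,\theta)}\le-1. \]
   Context: $\mathbb{H}=\{z\in\mathbb{C}:\mathrm{Im}(z)>0\}$ and $\overline{\mathbb{H}}=\mathbb{H}\cup\mathbb{R}$. For $\theta=\mu+\sigma i\in\mathbb{H}$, $P_\theta(dx)=p(x;\theta)\,dx$ on $\mathbb{R}$ with $p(x;\theta)=\frac{\sigma}{\pi}\frac{1}{(x-\mu)^2+\sigma^2}$. Admissible generator: a function $f:U\to\mathbb{C}$ for which there is a point $a\in\mathbb{C}$ with $\mathrm{Im}(a)\le 0$ such that $U\subset\mathbb{C}$ is a domain containing $\overline{\mathbb{H}}\setminus\{a\}$, $f$ is (continuous) injective and holomorphic on $U$, the set $f(\overline{\mathbb{H}}\setminus\{a\})$ is convex, $\lim_{z\to a}(z-a)f(z)=0$, and $\lim_{|z|\to\infty}f(z)/|z|=0$.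 By the residue theorem $E[f(X_1)]=f(\theta)$. By convexity, $\frac1n\sum_{j=1}^n f(X_j)$ lies almost surely in $f(\overline{\mathbb{H}}\setminus\{a\})$, so $Y_n$ is well defined with values in $\overline{\mathbb{H}}\setminus\{a\}$. Kullback–Leibler divergence: $K(P_{\theta'}|P_\theta)=\int_{\mathbb{R}}p(x;\theta')\log\frac{p(x;\theta')}{p(x;\theta)}\,dx$. Define, for $\epsilon>0$, \[ b(\epsilon,\theta)=\inf\{K(P_{\theta'}|P_\theta):\theta'\in\mathbb{H},\ |\theta'-\theta|>\epsilon\}. \] *)

theory Defs
  imports "HOL-Probability.Probability" "HOL-Complex_Analysis.Complex_Analysis"
begin

definition upper_half_plane :: "complex set" where
  "upper_half_plane = {z. Im z > 0}"

definition closed_upper_half_plane :: "complex set" where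
  "closed_upper_half_plane = upper_half_plane \<union> \<real>"

definition cauchy_density :: "complex \<Rightarrow> real \<Rightarrow> real" where
  "cauchy_density \<theta> x = Im \<theta> / pi * (1 / ((x - Re \<theta>)\<^sup>2 + (Im \<theta>)\<^sup>2))"

definition cauchy_distribution :: "complex \<Rightarrow> real measure" where
  "cauchy_distribution \<theta> = density lborel (cauchy_density \<theta>)"

text \<open>
  The two limits are taken inside the domain \<open>U\<close> of \<open>f\<close>.  In particular the first one is vacuous
  when \<open>a\<close> lies outside the closure of \<open>U\<close>, which can only happen for \<open>Im a < 0\<close>.
\<close>

definition admissible_generator :: "complex set \<Rightarrow> (complex \<Rightarrow> complex) \<Rightarrow> bool" where
  "admissible_generator U f \<longleftrightarrow>
    open U \<and> connected U \<and> inj_on f U \<and> f holomorphic_on U \<and>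
    (\<exists>a. Im a \<le> 0 \<and>
       closed_upper_half_plane - {a} \<subseteq> U \<and>
       convex (f ` (closed_upper_half_plane - {a})) \<and>
       ((\<lambda>z. (z - a) * f z) \<longlongrightarrow> 0) (at a within U) \<and>
       ((\<lambda>z. f z / complex_of_real (cmod z)) \<longlongrightarrow> 0) (inf at_infinity (principal U)))"

text \<open>
  The estimators, as functions of the data \<open>x 1, \<dots>, x n\<close>.  The inverse of \<open>f\<close> is that of the
  injection \<open>f\<close> on \<open>U\<close>; its value outside \<open>f ` U\<close> is a constant without meaning, relevant
  only on the null event that some data point equals the exceptional point \<open>a\<close>.
\<close>

definition quasi_arithmetic_mean ::
    "complex set \<Rightarrow> (complex \<Rightarrow> complex) \<Rightarrow> nat \<Rightarrow> (nat \<Rightarrow> real) \<Rightarrow> complex" where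
  "quasi_arithmetic_mean U f n x =
    inv_into U f (1 / of_nat n * (\<Sum>j=1..n. f (complex_of_real (x j))))"

text \<open>
  A summand below has denominator zero only if \<open>y\<close> is real, in which case the factor \<open>Im y\<close>
  removes the correction term.
\<close>

definition one_step_estimator ::
    "complex set \<Rightarrow> (complex \<Rightarrow> complex) \<Rightarrow> nat \<Rightarrow> (nat \<Rightarrow> real) \<Rightarrow> complex" where
  "one_step_estimator U f n x =
    (let y = quasi_arithmetic_mean U f n x in
       y + 2 * complex_of_real (Im y) * \<i> / of_nat n *
         (\<Sum>j=1..n. (complex_of_real (x j) - y) / (complex_of_real (x j) - cnj y)))"

text \<open>
  The library's \<open>KL_divergence b M N\<close> is the divergence of \<open>N\<close> from the reference measure \<open>M\<close>,
  so the arguments of \<open>K(P|Q)\<close> are swapped.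
\<close>

definition cauchy_KL :: "complex \<Rightarrow> complex \<Rightarrow> real" where
  "cauchy_KL \<theta>' \<theta> =
    KL_divergence (exp 1) (cauchy_distribution \<theta>) (cauchy_distribution \<theta>')"

lemma cauchy_density_pos:
  assumes "\<theta> \<in> upper_half_plane"
  shows "cauchy_density \<theta> x > 0"
proof -
  have "(x - Re \<theta>)\<^sup>2 + (Im \<theta>)\<^sup>2 > 0"
    using assms by (intro add_nonneg_pos) (auto simp: upper_half_plane_def)
  then show ?thesis
    using assms by (simp add: cauchy_density_def upper_half_plane_def)
qed

lemma borel_measurable_cauchy_density [measurable]: "cauchy_density \<theta> \<in> borel_measurable borel"
  unfolding cauchy_density_def by measurable

lemma cauchy_KL_eq_integral:
  assumes "\<theta>' \<in> upper_half_plane" "\<theta> \<in> upper_half_plane"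
  shows "cauchy_KL \<theta>' \<theta> =
    (LINT x|lborel. cauchy_density \<theta>' x * ln (cauchy_density \<theta>' x / cauchy_density \<theta> x))"
proof -
  have pos: "cauchy_density \<theta>' x > 0" "cauchy_density \<theta> x > 0" for x
    using assms by (auto intro: cauchy_density_pos)
  show ?thesis
    unfolding cauchy_KL_def cauchy_distribution_def
    by (subst lborel.KL_density_density)
      (auto simp: log_def less_imp_le[OF pos(1)] less_imp_le[OF pos(2)]
        pos(1)[THEN less_imp_neq, symmetric] pos(2)[THEN less_imp_neq, symmetric])
qed

definition bahadur_bound :: "real \<Rightarrow> complex \<Rightarrow> real" where
  "bahadur_bound \<epsilon> \<theta> =
    Inf {cauchy_KL \<theta>' \<theta> |\<theta>'. \<theta>' \<in> upper_half_plane \<and> cmod (\<theta>' - \<theta>) > \<epsilon>}"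

text \<open>The library has \<open>ln 0 = 0\<close> on the reals; for probabilities the value \<open>- \<infinity>\<close> is needed.\<close>

definition ereal_ln :: "real \<Rightarrow> ereal" where
  "ereal_ln p = (if p = 0 then - \<infinity> else ereal (ln p))"

end

theory Submission
  imports Defs
begin

text \<open>
  Write \<open>W\<^sub>j = (X\<^sub>j - \<theta>) / (X\<^sub>j - cnj \<theta>)\<close>, which has modulus one, and \<open>d = Y\<^sub>n - \<theta>\<close>.  Expanding the
  estimator around \<open>\<theta>\<close> gives
  \<open>Z\<^sub>n - \<theta> = (2 \<i> \<sigma> + 2 d) avg W - cnj d * avg W\<^sup>2 + O(d\<^sup>2)\<close>, where \<open>avg\<close> is the sample mean.
  By the Poisson formula for the half plane \<open>W\<close>, \<open>W\<^sup>2\<close> and \<open>f(X) - f(\<theta>)\<close> have mean zero,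
  so Chernoff's bound makes the deviations of the three sample means of order \<open>\<epsilon>\<close> exponentially
  unlikely, at a rate quadratic in \<open>\<epsilon>\<close>.  Since \<open>f\<close> has a locally Lipschitz inverse, \<open>d\<close> and
  \<open>avg W\<^sup>2\<close> are at most a large multiple of \<open>\<epsilon>\<close> outside an event of negligible probability, and
  then \<open>|Z\<^sub>n - \<theta>| > \<epsilon>\<close> forces \<open>2 \<sigma> |avg W|\<close> to exceed \<open>\<epsilon> - O(\<epsilon>\<^sup>2)\<close>.  As every real component of
  \<open>W\<close> has variance \<open>1/2\<close>, this happens at rate \<open>\<epsilon>\<^sup>2 / (4 \<sigma>\<^sup>2)\<close> to leading order.  A real
  translation of \<open>\<theta>\<close> shows that \<open>b(\<epsilon>, \<theta>)\<close> is not larger than that.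
\<close>

section \<open>The Poisson formula for the Cauchy distribution\<close>

lemma closed_upper_half_plane_altdef: "closed_upper_half_plane = {z. 0 \<le> Im z}"
  by (auto simp: closed_upper_half_plane_def upper_half_plane_def complex_is_Real_iff)

text \<open>For \<open>\<theta>\<close> in the upper half plane this exhibits the density as the
  restriction of a rational function whose only pole in that half plane is the simple one at
  \<open>\<theta>\<close>.\<close>

lemma cauchy_denominator:
  "complex_of_real ((x - Re \<theta>)\<^sup>2 + (Im \<theta>)\<^sup>2) = (of_real x - \<theta>) * (of_real x - cnj \<theta>)"
  by (simp add: complex_eq_iff power2_eq_square algebra_simps)

lemma integrable_cauchy_density:
  assumes "0 < Im \<theta>"
  shows "integrable lborel (cauchy_density \<theta>)"
proof -
  have "integrable lborel (\<lambda>x::real. inverse (1 + x\<^sup>2))"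
    using integrable_inverse_1_plus_square by (simp add: set_integrable_def)
  then have "integrable lborel (\<lambda>x. inverse (1 + (- Re \<theta> / Im \<theta> + 1 / Im \<theta> * x)\<^sup>2))"
    by (rule lborel_integrable_real_affine) (use assms in simp)
  then have "integrable lborel
      (\<lambda>x. 1 / (pi * Im \<theta>) * inverse (1 + (- Re \<theta> / Im \<theta> + 1 / Im \<theta> * x)\<^sup>2))"
    by (rule integrable_mult_right)
  also have "(\<lambda>x. 1 / (pi * Im \<theta>) * inverse (1 + (- Re \<theta> / Im \<theta> + 1 / Im \<theta> * x)\<^sup>2))
      = cauchy_density \<theta>"
  proof
    fix x
    have "1 + (- Re \<theta> / Im \<theta> + 1 / Im \<theta> * x)\<^sup>2 = ((x - Re \<theta>)\<^sup>2 + (Im \<theta>)\<^sup>2) / (Im \<theta>)\<^sup>2"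
      using assms by (simp add: field_simps power2_eq_square)
    then show "1 / (pi * Im \<theta>) * inverse (1 + (- Re \<theta> / Im \<theta> + 1 / Im \<theta> * x)\<^sup>2)
        = cauchy_density \<theta> x"
      using assms by (simp add: cauchy_density_def power2_eq_square)
  qed
  finally show ?thesis .
qed

text \<open>Contour integrals along the real axis are gauge integrals over \<open>{-R..R}\<close>;
  dominated convergence connects them with the Lebesgue integral over the line.\<close>

lemma tendsto_integral_symmetric_intervals:
  fixes h :: "real \<Rightarrow> complex"
  assumes "integrable lborel h"
  shows "(\<lambda>k. integral {- real k..real k} h) \<longlonglongrightarrow> (LINT x|lborel. h x)"
proof -
  have "(\<lambda>k. LINT x|lborel. indicator {- real k..real k} x *\<^sub>R h x) \<longlonglongrightarrow> (LINT x|lborel. h x)"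
  proof (rule integral_dominated_convergence)
    show "integrable lborel (\<lambda>x. norm (h x))"
      using assms by simp
    show "AE x in lborel. (\<lambda>k. indicator {- real k..real k} x *\<^sub>R h x) \<longlonglongrightarrow> h x"
    proof (rule AE_I2)
      fix x :: real
      have "eventually (\<lambda>k. indicator {- real k..real k} x *\<^sub>R h x = h x) sequentially"
        using eventually_ge_at_top[of "nat \<lceil>\<bar>x\<bar>\<rceil>"]
        by eventually_elim (auto simp: indicator_def; linarith)
      then show "(\<lambda>k. indicator {- real k..real k} x *\<^sub>R h x) \<longlonglongrightarrow> h x"
        by (rule tendsto_eventually)
    qed
  qed (use assms in \<open>auto simp: indicator_def\<close>)
  moreover have "(LINT x|lborel. indicator {- real k..real k} x *\<^sub>R h x) = integral {- real k..real k} h" for k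
  proof -
    have "set_integrable lborel {- real k..real k} h"
      unfolding set_integrable_def by (rule integrable_mult_indicator) (use assms in auto)
    from set_borel_integral_eq_integral(2)[OF this] show ?thesis
      by (simp add: set_lebesgue_integral_def)
  qed
  ultimately show ?thesis by simp
qed

lemma integrable_cauchy_density_scaleR:
  fixes F :: "real \<Rightarrow> complex"
  assumes "0 < Im \<theta>" "F \<in> borel_measurable borel" "\<And>x. norm (F x) \<le> B"
  shows "integrable lborel (\<lambda>x. cauchy_density \<theta> x *\<^sub>R F x)"
proof (rule Bochner_Integration.integrable_bound)
  show "integrable lborel (\<lambda>x. B * cauchy_density \<theta> x)"
    using integrable_cauchy_density[OF assms(1)] by simp
  show "AE x in lborel. norm (cauchy_density \<theta> x *\<^sub>R F x) \<le> norm (B * cauchy_density \<theta> x)"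
  proof (rule AE_I2)
    fix x
    have "0 \<le> cauchy_density \<theta> x"
      using cauchy_density_pos[of \<theta> x] assms(1) by (simp add: upper_half_plane_def)
    then show "norm (cauchy_density \<theta> x *\<^sub>R F x) \<le> norm (B * cauchy_density \<theta> x)"
      using mult_left_mono[OF order_trans[OF assms(3)[of x] abs_ge_self[of B]]]
      by (simp add: abs_mult mult.commute[of "\<bar>B\<bar>"])
  qed
qed (use assms in simp)

lemma continuous_on_real_line_measurable:
  assumes "continuous_on closed_upper_half_plane F"
  shows "(\<lambda>x. F (complex_of_real x)) \<in> borel_measurable borel"
  by (intro borel_measurable_continuous_onI continuous_on_compose2[OF assms] continuous_intros)
    (auto simp: closed_upper_half_plane_altdef)

text \<open>Cauchy's integral formula on the rectangle with base \<open>{-R..R}\<close> and height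
  \<open>R\<close>. The integrand is of order \<open>1 / R\<^sup>2\<close> on the three other sides,
  so these contribute \<open>O(1 / R)\<close>, and the base tends to the integral against the
  density.\<close>

theorem cauchy_mean_bounded_holomorphic:
  assumes \<theta>: "0 < Im \<theta>"
    and cont: "continuous_on closed_upper_half_plane F"
    and holo: "F holomorphic_on upper_half_plane"
    and bound: "\<And>z. 0 \<le> Im z \<Longrightarrow> norm (F z) \<le> B"
  shows "(LINT x|lborel. cauchy_density \<theta> x *\<^sub>R F (complex_of_real x)) = F \<theta>"
proof -
  define S where "S = {z. 0 \<le> Im z}"
  have S: "S = closed_upper_half_plane" "convex S" "interior S = upper_half_plane"
    using convex_halfspace_Im_ge[of 0] interior_halfspace_ge[of \<i> 0]
    by (auto simp: S_def closed_upper_half_plane_altdef upper_half_plane_def inner_complex_def)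
  \<comment> \<open>\<open>g\<close> takes up the pole at \<open>cnj \<theta>\<close>, which lies
    below the real axis; \<open>H\<close> then has only the simple pole at \<open>\<theta>\<close>
    in the half plane.\<close>
  define g where "g z = F z / (z - cnj \<theta>)" for z
  define H where "H z = g z / (z - \<theta>)" for z
  have nz: "z - cnj \<theta> \<noteq> 0" if "z \<in> S" for z
    using that \<theta> by (auto simp: S_def complex_eq_iff)
  have contg: "continuous_on S g"
    unfolding g_def using nz cont by (intro continuous_intros) (auto simp: S(1))
  have B0: "0 \<le> B"
    using bound[of 0] norm_ge_zero[of "F 0"] by (simp del: norm_ge_zero)
  have kernel: "cauchy_density \<theta> x *\<^sub>R F (complex_of_real x) = of_real (Im \<theta> / pi) * H (of_real x)" for x
    unfolding H_def g_def cauchy_density_def scaleR_conv_of_real of_real_mult of_real_divide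
      cauchy_denominator by (simp add: field_simps)
  have intH: "integrable lborel (\<lambda>x. H (complex_of_real x))"
  proof -
    have "integrable lborel (\<lambda>x. cauchy_density \<theta> x *\<^sub>R F (complex_of_real x))"
      by (rule integrable_cauchy_density_scaleR[where B=B])
        (use \<theta> bound continuous_on_real_line_measurable[OF cont] in auto)
    then have "integrable lborel (\<lambda>x. of_real (pi / Im \<theta>) * (cauchy_density \<theta> x *\<^sub>R F (complex_of_real x)))"
      by (rule integrable_mult_right)
    also have "(\<lambda>x. of_real (pi / Im \<theta>) * (cauchy_density \<theta> x *\<^sub>R F (complex_of_real x))) = (\<lambda>x. H (of_real x))"
      unfolding kernel using \<theta> by (auto simp: field_simps)
    finally show ?thesis .
  qed
  \<comment> \<open>\<open>R > 2 * norm \<theta>\<close> makes both factors of the denominator at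
    least \<open>R / 2\<close> on the far sides, so
    \<open>norm (H z) \<le> 4 * B / R\<^sup>2\<close> there; their total length \<open>4 * R\<close>
    gives the constant 16.\<close>
  have est: "norm (integral {-R..R} (\<lambda>x. H (of_real x)) - 2 * pi * \<i> * g \<theta>) \<le> 16 * B / R"
    if R: "R > 2 * norm \<theta>" "R > 0" for R
  proof -
    define c1 c2 c3 c4 where "c1 = Complex (-R) 0" "c2 = Complex R 0" "c3 = Complex R R" "c4 = Complex (-R) R"
    have rect: "rectpath c1 c3 = linepath c1 c2 +++ linepath c2 c3 +++ linepath c3 c4 +++ linepath c4 c1"
      by (simp add: rectpath_def Let_def c1_c2_c3_c4_def)
    have \<theta>R: "\<bar>Re \<theta>\<bar> < R" "\<bar>Im \<theta>\<bar> < R"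
      using R abs_Re_le_cmod[of \<theta>] abs_Im_le_cmod[of \<theta>] by linarith+
    have pimg: "path_image (rectpath c1 c3) =
       {z. Re z \<in> {-R, R} \<and> Im z \<in> {0..R}} \<union> {z. Im z \<in> {0, R} \<and> Re z \<in> {-R..R}}"
      using R by (subst path_image_rectpath) (auto simp: c1_c2_c3_c4_def)
    have sub: "path_image (rectpath c1 c3) \<subseteq> S - {\<theta>}"
      unfolding pimg using \<theta>R \<theta> R by (auto simp: S_def)
    \<comment> \<open>The base lies on the boundary of \<open>S\<close>, where \<open>F\<close> is
      merely continuous; the convex form of Cauchy's formula asks for differentiability only in the
      interior.\<close>
    have "(H has_contour_integral (2 * pi * \<i> * winding_number (rectpath c1 c3) \<theta> * g \<theta>)) (rectpath c1 c3)"
      unfolding H_def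
    proof (rule Cauchy_integral_formula_convex[where S=S and K="{}"])
      show "g field_differentiable at x" if "x \<in> interior S - {}" for x
      proof -
        have "g holomorphic_on upper_half_plane"
          unfolding g_def using holo nz
          by (intro holomorphic_intros) (auto simp: S_def upper_half_plane_def)
        then show ?thesis
          using that S(3) interior_subset[of S] open_interior[of S]
          by (metis Diff_empty holomorphic_on_imp_differentiable_at)
      qed
      show "\<theta> \<in> interior S" using S(3) \<theta> by (simp add: upper_half_plane_def)
    qed (use S contg sub in auto)
    moreover have "winding_number (rectpath c1 c3) \<theta> = 1"
      by (rule winding_number_rectpath) (use \<theta>R \<theta> in \<open>auto simp: in_box_complex_iff c1_c2_c3_c4_def\<close>)
    ultimately have main: "contour_integral (rectpath c1 c3) H = 2 * pi * \<i> * g \<theta>"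
      by (simp add: contour_integral_unique)
    have contH: "continuous_on (path_image (rectpath c1 c3)) H"
      unfolding H_def using sub contg by (intro continuous_intros) (auto intro: continuous_on_subset)
    have subs: "closed_segment c1 c2 \<subseteq> path_image (rectpath c1 c3)"
      "closed_segment c2 c3 \<subseteq> path_image (rectpath c1 c3)"
      "closed_segment c3 c4 \<subseteq> path_image (rectpath c1 c3)"
      "closed_segment c4 c1 \<subseteq> path_image (rectpath c1 c3)"
      unfolding rect by (auto simp: path_image_join)
    have ci: "H contour_integrable_on linepath c1 c2" "H contour_integrable_on linepath c2 c3"
      "H contour_integrable_on linepath c3 c4" "H contour_integrable_on linepath c4 c1"
      using subs by (auto intro!: contour_integrable_continuous_linepath continuous_on_subset[OF contH])
    have split: "contour_integral (rectpath c1 c3) H = contour_integral (linepath c1 c2) H +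
        (contour_integral (linepath c2 c3) H + (contour_integral (linepath c3 c4) H + contour_integral (linepath c4 c1) H))"
      unfolding rect using ci by (simp add: contour_integrable_joinI)
    have bot: "contour_integral (linepath c1 c2) H = integral {-R..R} (\<lambda>x. H (of_real x))"
      using R by (subst contour_integral_linepath_Reals_eq) (auto simp: c1_c2_c3_c4_def complex_is_Real_iff)
    have Hb: "norm (H z) \<le> 4 * B / R\<^sup>2" if "z \<in> path_image (rectpath c1 c3)" "norm z \<ge> R" for z
    proof -
      have 1: "norm (z - \<theta>) \<ge> R / 2" "norm (z - cnj \<theta>) \<ge> R / 2"
        using that R norm_triangle_ineq2[of z \<theta>] norm_triangle_ineq2[of z "cnj \<theta>"] by auto
      have "0 \<le> Im z" using that sub by (auto simp: S_def)
      then have "norm (F z) \<le> B" by (rule bound)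
      moreover have "norm (z - cnj \<theta>) * norm (z - \<theta>) \<ge> (R / 2) * (R / 2)"
        using 1 R by (intro mult_mono) auto
      ultimately have "norm (F z) / (norm (z - cnj \<theta>) * norm (z - \<theta>)) \<le> B / ((R / 2) * (R / 2))"
        using R B0 by (intro frac_le) auto
      then show ?thesis
        by (simp add: H_def g_def norm_divide norm_mult power2_eq_square mult.commute[of B])
    qed
    have segs: "closed_segment c2 c3 \<subseteq> {z. R \<le> norm z}" "closed_segment c3 c4 \<subseteq> {z. R \<le> norm z}"
      "closed_segment c4 c1 \<subseteq> {z. R \<le> norm z}"
    proof -
      have "R \<le> norm z" if "\<bar>Re z\<bar> = R \<or> \<bar>Im z\<bar> = R" for z
        using that abs_Re_le_cmod[of z] abs_Im_le_cmod[of z] by auto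
      then show "closed_segment c2 c3 \<subseteq> {z. R \<le> norm z}" "closed_segment c3 c4 \<subseteq> {z. R \<le> norm z}"
        "closed_segment c4 c1 \<subseteq> {z. R \<le> norm z}"
        using R by (auto simp: c1_c2_c3_c4_def closed_segment_same_Re closed_segment_same_Im)
    qed
    have side: "norm (contour_integral (linepath p q) H) \<le> 4 * B / R\<^sup>2 * norm (q - p)"
      if "H contour_integrable_on linepath p q" "closed_segment p q \<subseteq> path_image (rectpath c1 c3)"
        "closed_segment p q \<subseteq> {z. R \<le> norm z}" for p q
      using that(1) by (rule contour_integral_bound_linepath) (use that Hb B0 in auto)
    have "norm (contour_integral (linepath c2 c3) H) \<le> 4 * B / R\<^sup>2 * norm (c3 - c2)"
      "norm (contour_integral (linepath c3 c4) H) \<le> 4 * B / R\<^sup>2 * norm (c4 - c3)"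
      "norm (contour_integral (linepath c4 c1) H) \<le> 4 * B / R\<^sup>2 * norm (c1 - c4)"
      by (intro side ci subs segs)+
    moreover have "norm (c3 - c2) = R" "norm (c4 - c3) = 2 * R" "norm (c1 - c4) = R"
      using R by (auto simp: c1_c2_c3_c4_def cmod_def complex_diff real_sqrt_mult)
    moreover have "norm (contour_integral (rectpath c1 c3) H - contour_integral (linepath c1 c2) H) \<le>
        norm (contour_integral (linepath c2 c3) H) + (norm (contour_integral (linepath c3 c4) H)
        + norm (contour_integral (linepath c4 c1) H))"
      unfolding split by (simp, intro norm_triangle_le add_left_mono norm_triangle_ineq)
    ultimately have "norm (contour_integral (rectpath c1 c3) H - contour_integral (linepath c1 c2) H) \<le>
        4 * B / R\<^sup>2 * R + (4 * B / R\<^sup>2 * (2 * R) + 4 * B / R\<^sup>2 * R)"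
      by simp
    also have "\<dots> = 16 * B / R" using R by (simp add: field_simps power2_eq_square)
    finally show ?thesis
      unfolding main bot by (simp add: norm_minus_commute)
  qed
  have "(\<lambda>k. integral {- real k..real k} (\<lambda>x. H (of_real x))) \<longlonglongrightarrow> 2 * pi * \<i> * g \<theta>"
  proof (rule LIM_zero_cancel, rule Lim_null_comparison)
    show "(\<lambda>k. 16 * B / real k) \<longlonglongrightarrow> 0" by real_asymp
    obtain K :: nat where K: "real K > 2 * norm \<theta>" using reals_Archimedean2 by blast
    show "eventually (\<lambda>k. norm (integral {- real k..real k} (\<lambda>x. H (of_real x)) - 2 * pi * \<i> * g \<theta>) \<le> 16 * B / real k) sequentially"
      using eventually_ge_at_top[of K] eventually_gt_at_top[of 0]
      by eventually_elim (rule est; use K in simp)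
  qed
  then have "(LINT x|lborel. H (complex_of_real x)) = 2 * pi * \<i> * g \<theta>"
    using tendsto_integral_symmetric_intervals[OF intH] LIMSEQ_unique by blast
  \<comment> \<open>The division by \<open>\<theta> - cnj \<theta>\<close> in
    \<open>g \<theta>\<close> cancels the remaining constants.\<close>
  moreover have "of_real (Im \<theta> / pi) * (2 * pi * \<i> * g \<theta>) = F \<theta>"
  proof -
    have "\<theta> - cnj \<theta> = 2 * \<i> * of_real (Im \<theta>)" by (simp add: complex_eq_iff)
    then show ?thesis using \<theta> by (simp add: g_def)
  qed
  ultimately show ?thesis
    unfolding kernel by simp
qed

section \<open>Generators with a singularity at \<open>a\<close> and growth at infinity\<close>

lemma norm_damping_factor_le:
  assumes "0 \<le> Im \<zeta>" "0 < e"
  shows "norm (\<zeta> / (\<zeta> + \<i> * of_real e)) \<le> 1" "norm (\<i> / (\<zeta> * of_real e + \<i>)) \<le> 1"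
proof -
  \<comment> \<open>Adding \<open>\<i> * e\<close> to a point with nonnegative imaginary part
    increases its modulus; the denominator of the second factor has imaginary part at least
    one.\<close>
  have "norm \<zeta> \<le> norm (\<zeta> + \<i> * of_real e)"
    using assms power_mono[of "Im \<zeta>" "Im \<zeta> + e" 2] by (simp add: cmod_def)
  then show "norm (\<zeta> / (\<zeta> + \<i> * of_real e)) \<le> 1"
    by (simp add: norm_divide divide_le_eq_1)
  have "\<bar>Im (\<zeta> * of_real e + \<i>)\<bar> \<le> norm (\<zeta> * of_real e + \<i>)"
    by (rule abs_Im_le_cmod)
  moreover have "0 \<le> Im \<zeta> * e" using assms by simp
  ultimately have "1 \<le> norm (\<zeta> * of_real e + \<i>)"
    by simp
  then show "norm (\<i> / (\<zeta> * of_real e + \<i>)) \<le> 1"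
    by (simp add: norm_divide divide_le_eq_1)
qed

text \<open>
  The factor \<open>\<zeta> / (\<zeta> + \<i> e) * (\<i> / (e \<zeta> + \<i>))\<close> with \<open>\<zeta> = z - a\<close> has modulus at most one on the
  closed half plane, tends to one as \<open>e\<close> tends to zero, cancels the singularity at \<open>a\<close> and
  compensates the growth at infinity.
\<close>

theorem cauchy_mean_admissible:
  assumes \<theta>: "0 < Im \<theta>" and a: "Im a \<le> 0"
    and U: "open U" "closed_upper_half_plane - {a} \<subseteq> U"
    and holo: "f holomorphic_on U"
    and lim_a: "((\<lambda>z. (z - a) * f z) \<longlongrightarrow> 0) (at a within U)"
    and lim_inf: "((\<lambda>z. f z / complex_of_real (cmod z)) \<longlongrightarrow> 0) (inf at_infinity (principal U))"
    and int: "integrable lborel (\<lambda>x. cauchy_density \<theta> x *\<^sub>R f (complex_of_real x))"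
  shows "(LINT x|lborel. cauchy_density \<theta> x *\<^sub>R f (complex_of_real x)) = f \<theta>"
proof -
  define C where "C = closed_upper_half_plane"
  have C: "z \<in> C \<longleftrightarrow> 0 \<le> Im z" for z
    by (simp add: C_def closed_upper_half_plane_altdef)
  define G where "G z = (z - a) * f z" for z
  \<comment> \<open>Written with \<open>G\<close>, this is continuous even at \<open>a\<close>;
    \<open>F_eq\<close> is the same function as a product of damping factors and \<open>f\<close>,
    the form used for estimates.\<close>
  define F where "F e z = G z * ((1 / (z - a + \<i> * of_real e)) * (\<i> / ((z - a) * of_real e + \<i>)))" for e z
  have contG: "continuous_on C G"
    unfolding continuous_on_def
  proof
    fix z assume z: "z \<in> C"
    show "(G \<longlongrightarrow> G z) (at z within C)"
    proof (cases "z = a")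
      case True
      \<comment> \<open>\<open>G a = 0\<close> whatever value \<open>f\<close> has at
        \<open>a\<close>, so the limit hypothesis gives continuity of \<open>G\<close>
        there.\<close>
      have "(G \<longlongrightarrow> 0) (at a within (C - {a}))"
        using tendsto_within_subset[OF lim_a U(2)] by (simp add: G_def[abs_def] C_def)
      then have "(G \<longlongrightarrow> 0) (at a within C)"
        by (simp add: at_within_def)
      then show ?thesis using True by (simp add: G_def)
    next
      case False
      then have "z \<in> U" using z U(2) by (auto simp: C_def)
      then have "isCont f z"
        using holo U(1) holomorphic_on_imp_continuous_on continuous_on_eq_continuous_at by blast
      then have "isCont G z"
        unfolding G_def by (intro continuous_intros)
      then show ?thesis
        by (simp add: continuous_at_imp_continuous_at_within continuous_within[symmetric])
    qed
  qed
  have nz: "z - a + \<i> * of_real e \<noteq> 0" "(z - a) * of_real e + \<i> \<noteq> 0" if "z \<in> C" "0 < e" for z e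
  proof -
    have "0 < Im (z - a + \<i> * of_real e)" using that a by (simp add: C)
    then show "z - a + \<i> * of_real e \<noteq> 0" by (metis less_irrefl zero_complex.sel(2))
    have "0 \<le> (Im z - Im a) * e" using that a by (simp add: C)
    then have "0 < Im ((z - a) * of_real e + \<i>)" by simp
    then show "(z - a) * of_real e + \<i> \<noteq> 0" by (metis less_irrefl zero_complex.sel(2))
  qed
  have F_eq: "F e z = ((z - a) / (z - a + \<i> * of_real e)) * (\<i> / ((z - a) * of_real e + \<i>)) * f z" for e z
    by (simp add: F_def G_def)
  have contF: "continuous_on C (F e)" if "0 < e" for e
    unfolding F_def using nz that by (intro continuous_intros contG) auto
  have holoF: "F e holomorphic_on upper_half_plane" if "0 < e" for e
  proof -
    have "upper_half_plane \<subseteq> U" using U(2) a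
      by (auto simp: closed_upper_half_plane_def upper_half_plane_def)
    then show ?thesis
      unfolding F_def G_def using nz that
      by (intro holomorphic_intros holomorphic_on_subset[OF holo])
        (auto simp: C upper_half_plane_def)
  qed
  have F_le: "norm (F e z) \<le> norm (f z)" if "z \<in> C" "0 < e" for e z
  proof -
    have "0 \<le> Im (z - a)" using that a by (simp add: C)
    note damp = norm_damping_factor_le[OF this \<open>0 < e\<close>]
    have "norm ((z - a) / (z - a + \<i> * of_real e)) * norm (\<i> / ((z - a) * of_real e + \<i>)) * norm (f z)
        \<le> 1 * 1 * norm (f z)"
      by (intro mult_mono damp) auto
    then show ?thesis
      unfolding F_eq norm_mult by simp
  qed
  \<comment> \<open>Far out, \<open>norm (f z) \<le> norm z\<close> is compensated by the second
    damping factor, at most \<open>2 / (e * norm z)\<close>; on the remaining compact set continuity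
    suffices.\<close>
  have boundF: "\<exists>B. \<forall>z. 0 \<le> Im z \<longrightarrow> norm (F e z) \<le> B" if e: "0 < e" for e
  proof -
    have "eventually (\<lambda>z. norm (f z / of_real (cmod z)) < 1) (inf at_infinity (principal U))"
      using tendstoD[OF lim_inf, of 1] by simp
    then obtain R0 where R0: "\<And>z. R0 \<le> norm z \<Longrightarrow> z \<in> U \<Longrightarrow> norm (f z) / norm z < 1"
      by (auto simp: eventually_inf_principal eventually_at_infinity norm_divide)
    define R where "R = max R0 (2 * (norm a + 1 / e) + 1)"
    have R: "R0 \<le> R" "2 * (norm a + 1 / e) < R" by (auto simp: R_def)
    have far: "norm (F e z) \<le> 2 / e" if z: "z \<in> C" "R \<le> norm z" for z
    proof -
      have pos: "0 < norm z" "norm a < norm z"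
      proof -
        have "0 < 1 / e" using e by simp
        then show "0 < norm z" "norm a < norm z"
          using R z norm_ge_zero[of a] by (smt (verit))+
      qed
      then have zU: "z \<in> U" using z U(2) by (auto simp: C_def)
      have fz: "norm (f z) \<le> norm z"
        using R0[OF _ zU] R z pos by (simp add: divide_less_eq)
      have "e * (norm z / 2) \<le> e * (norm z - norm a - 1 / e)"
        using R z e by (intro mult_left_mono) auto
      also have "\<dots> = e * (norm z - norm a) - 1"
        using e by (simp add: right_diff_distrib)
      also have "\<dots> \<le> e * norm (z - a) - 1"
        using e norm_triangle_ineq2[of z a] by simp
      also have "\<dots> \<le> norm ((z - a) * of_real e + \<i>)"
        using norm_triangle_ineq2[of "(z - a) * of_real e" "-\<i>"] e by (simp add: norm_mult mult.commute)
      finally have den: "e * (norm z / 2) \<le> norm ((z - a) * of_real e + \<i>)" .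
      have "0 \<le> Im (z - a)" using z a by (simp add: C)
      note d1 = norm_damping_factor_le(1)[OF this e]
      have "norm (\<i> / ((z - a) * of_real e + \<i>)) \<le> 1 / (e * (norm z / 2))"
        unfolding norm_divide norm_ii using den e pos by (intro frac_le) auto
      then have "norm (F e z) \<le> 1 * (1 / (e * (norm z / 2))) * norm z"
        unfolding F_eq norm_mult using d1 fz e by (intro mult_mono) auto
      then show ?thesis using e pos by (simp add: field_simps)
    qed
    have "compact (C \<inter> cball 0 R)"
      using closed_halfspace_Im_ge[of 0]
      by (auto simp: C_def closed_upper_half_plane_altdef intro: closed_Int_compact)
    then have "compact (F e ` (C \<inter> cball 0 R))"
      by (intro compact_continuous_image continuous_on_subset[OF contF[OF e]]) auto
    then obtain B where "\<forall>w \<in> F e ` (C \<inter> cball 0 R). norm w \<le> B"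
      using compact_imp_bounded bounded_iff by blast
    then have B: "norm (F e z) \<le> B" if "z \<in> C" "norm z \<le> R" for z
      using that by simp
    have "norm (F e z) \<le> max B (2 / e)" if "0 \<le> Im z" for z
      using B[of z] far[of z] that by (cases "norm z \<le> R") (auto simp: C le_max_iff_disj)
    then show ?thesis by blast
  qed
  define e where "e k = inverse (real (Suc k))" for k
  have e: "0 < e k" for k by (simp add: e_def)
  have elim: "e \<longlonglongrightarrow> 0"
    unfolding e_def by (rule LIMSEQ_inverse_real_of_nat)
  have Flim: "(\<lambda>k. F (e k) z) \<longlonglongrightarrow> f z" if "z \<noteq> a" for z
    unfolding F_eq using that by (auto intro!: tendsto_eq_intros elim)
  have Fmean: "(LINT x|lborel. cauchy_density \<theta> x *\<^sub>R F (e k) (complex_of_real x)) = F (e k) \<theta>" for k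
  proof -
    obtain B where "\<And>z. 0 \<le> Im z \<Longrightarrow> norm (F (e k) z) \<le> B" using boundF[OF e] by blast
    then show ?thesis
      by (intro cauchy_mean_bounded_holomorphic[where B = B] \<theta> contF[OF e, unfolded C_def] holoF[OF e]) auto
  qed
  \<comment> \<open>The bounded case applies to every \<open>F (e k)\<close>. By \<open>F_le\<close>
    the integrable function \<open>f\<close> dominates them all, and convergence can fail only at
    the single point \<open>Re a\<close>.\<close>
  have "(\<lambda>k. LINT x|lborel. cauchy_density \<theta> x *\<^sub>R F (e k) (complex_of_real x))
      \<longlonglongrightarrow> (LINT x|lborel. cauchy_density \<theta> x *\<^sub>R f (complex_of_real x))"
  proof (rule integral_dominated_convergence)
    show "(\<lambda>x. cauchy_density \<theta> x *\<^sub>R f (complex_of_real x)) \<in> borel_measurable lborel"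
      using int by auto
    show "(\<lambda>x. cauchy_density \<theta> x *\<^sub>R F (e k) (complex_of_real x)) \<in> borel_measurable lborel" for k
      using continuous_on_real_line_measurable[OF contF[OF e[of k], unfolded C_def]] by simp
    show "integrable lborel (\<lambda>x. norm (cauchy_density \<theta> x *\<^sub>R f (complex_of_real x)))"
      by (rule integrable_norm[OF int])
    show "AE x in lborel. (\<lambda>k. cauchy_density \<theta> x *\<^sub>R F (e k) (complex_of_real x))
        \<longlonglongrightarrow> cauchy_density \<theta> x *\<^sub>R f (complex_of_real x)"
      using AE_lborel_singleton[of "Re a"] by eventually_elim (auto intro!: tendsto_intros Flim)
    show "AE x in lborel. norm (cauchy_density \<theta> x *\<^sub>R F (e k) (complex_of_real x))
        \<le> norm (cauchy_density \<theta> x *\<^sub>R f (complex_of_real x))" for k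
      by (rule AE_I2) (auto simp: C intro!: mult_left_mono F_le e)
  qed
  moreover have "(\<lambda>k. F (e k) \<theta>) \<longlonglongrightarrow> f \<theta>"
    by (rule Flim) (use \<theta> a in auto)
  ultimately show ?thesis
    unfolding Fmean by (rule LIMSEQ_unique)
qed

section \<open>Moderate deviations of sample means\<close>

text \<open>Taylor's formula with Lagrange remainder, giving up a factor \<open>1 / 6\<close>. An
  exponential moment controls a remainder of this form.\<close>

lemma exp_le_quadratic_plus_cubic:
  fixes x :: real
  shows "exp x \<le> 1 + x + x\<^sup>2 / 2 + \<bar>x\<bar> ^ 3 * exp \<bar>x\<bar>"
proof -
  obtain t where t: "\<bar>t\<bar> \<le> \<bar>x\<bar>" "exp x = (\<Sum>m<3. x ^ m / fact m) + exp t / fact 3 * x ^ 3"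
    using Maclaurin_exp_le[of x 3] by blast
  have "exp t / fact 3 * x ^ 3 \<le> exp t * \<bar>x ^ 3\<bar>"
  proof -
    have "exp t / fact 3 * x ^ 3 \<le> exp t / fact 3 * \<bar>x ^ 3\<bar>"
      by (intro mult_left_mono) auto
    also have "\<dots> \<le> exp t / 1 * \<bar>x ^ 3\<bar>"
      by (intro mult_right_mono divide_left_mono) (auto simp: fact_numeral)
    finally show ?thesis by simp
  qed
  also have "\<dots> \<le> exp \<bar>x\<bar> * \<bar>x ^ 3\<bar>"
    using t(1) by (intro mult_right_mono) auto
  finally show ?thesis
    using t(2) by (simp add: eval_nat_numeral power_abs mult.commute abs_mult)
qed

text \<open>\<open>x ^ k / fact k\<close> is one term of the exponential series, whose terms are all
  nonnegative.\<close>

lemma power_le_fact_exp: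
  fixes x :: real
  assumes "0 \<le> x"
  shows "x ^ k \<le> fact k * exp x"
proof -
  have "x ^ k /\<^sub>R fact k \<le> (\<Sum>n. x ^ n /\<^sub>R fact n)"
    using sum_le_suminf[OF summable_exp_generic[of x], of "{k}"] assms by auto
  then have "x ^ k / fact k \<le> exp x"
    by (simp add: exp_def divide_inverse mult.commute)
  then show ?thesis by (simp add: field_simps)
qed

lemma integrable_power_of_exponential_moment:
  fixes Y :: "'a \<Rightarrow> real"
  assumes [measurable]: "Y \<in> borel_measurable P" and s: "0 < s"
    and int: "integrable P (\<lambda>x. exp (s * \<bar>Y x\<bar>))"
  shows "integrable P (\<lambda>x. Y x ^ k)"
proof (rule Bochner_Integration.integrable_bound)
  show "integrable P (\<lambda>x. fact k / s ^ k * exp (s * \<bar>Y x\<bar>))"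
    using int by simp
  show "AE x in P. norm (Y x ^ k) \<le> norm (fact k / s ^ k * exp (s * \<bar>Y x\<bar>))"
    using power_le_fact_exp[of "s * \<bar>Y _\<bar>" k] s
    by (intro AE_I2) (simp add: power_abs power_mult_distrib field_simps)
qed measurable

text \<open>The linear Taylor term has mean zero and the quadratic one gives the variance; the cubic
  remainder \<open>t ^ 3 * K\<close> is absorbed, for small \<open>t\<close>, by the gap between the
  variance and \<open>v\<close>.\<close>

lemma (in prob_space) exponential_moment_le_gaussian:
  fixes Y :: "'a \<Rightarrow> real"
  assumes [measurable]: "Y \<in> borel_measurable M" and s: "0 < s"
    and int: "integrable M (\<lambda>x. exp (s * \<bar>Y x\<bar>))"
    and mean: "expectation Y = 0" and var: "expectation (\<lambda>x. (Y x)\<^sup>2) < v"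
  shows "\<exists>t0>0. \<forall>t. 0 \<le> t \<and> t \<le> t0 \<longrightarrow>
    (\<integral>\<^sup>+x. ennreal (exp (t * Y x)) \<partial>M) \<le> ennreal (exp (t\<^sup>2 * v / 2))"
proof -
  define E where "E = expectation (\<lambda>x. exp (s * \<bar>Y x\<bar>))"
  \<comment> \<open>Half of the exponential moment pays for the cube, \<open>\<bar>Y\<bar> ^ 3 \<le>
    6 * (2 / s) ^ 3 * exp (s / 2 * \<bar>Y\<bar>)\<close>, and the other half for
    \<open>exp (t * \<bar>Y\<bar>)\<close> with \<open>t \<le> s / 2\<close>.\<close>
  define K where "K = 6 * (2 / s) ^ 3 * E"
  define \<delta> where "\<delta> = v - expectation (\<lambda>x. (Y x)\<^sup>2)"
  have E: "0 \<le> E" unfolding E_def by simp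
  have K: "0 \<le> K" unfolding K_def using E s by simp
  have \<delta>: "0 < \<delta>" using var by (simp add: \<delta>_def)
  have intY: "integrable M Y" "integrable M (\<lambda>x. (Y x)\<^sup>2)"
    using integrable_power_of_exponential_moment[OF assms(1) s int, of 1]
      integrable_power_of_exponential_moment[OF assms(1) s int, of 2] by simp_all
  have bound: "(\<integral>\<^sup>+x. ennreal (exp (t * Y x)) \<partial>M) \<le> ennreal (exp (t\<^sup>2 * v / 2))"
    if t: "0 \<le> t" "t \<le> s / 2" "t * K \<le> \<delta> / 2" for t
  proof -
    define B where "B x = 1 + t * Y x + t\<^sup>2 / 2 * (Y x)\<^sup>2 + t ^ 3 * (6 * (2 / s) ^ 3) * exp (s * \<bar>Y x\<bar>)" for x
    have le: "exp (t * Y x) \<le> B x" for x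
    proof -
      have "\<bar>Y x\<bar> ^ 3 \<le> 6 * (2 / s) ^ 3 * exp (s / 2 * \<bar>Y x\<bar>)"
        using power_le_fact_exp[of "s / 2 * \<bar>Y x\<bar>" 3] s
        by (simp add: power_mult_distrib power_divide fact_numeral field_simps)
      then have "t ^ 3 * \<bar>Y x\<bar> ^ 3 * exp (t * \<bar>Y x\<bar>)
          \<le> t ^ 3 * (6 * (2 / s) ^ 3 * exp (s / 2 * \<bar>Y x\<bar>)) * exp (s / 2 * \<bar>Y x\<bar>)"
        using t s mult_right_mono[of t "s / 2" "\<bar>Y x\<bar>"] by (intro mult_mono mult_left_mono) auto
      also have "\<dots> = t ^ 3 * (6 * (2 / s) ^ 3) * (exp (s / 2 * \<bar>Y x\<bar>) * exp (s / 2 * \<bar>Y x\<bar>))"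
        by (simp only: mult.assoc)
      also have "exp (s / 2 * \<bar>Y x\<bar>) * exp (s / 2 * \<bar>Y x\<bar>) = exp (s * \<bar>Y x\<bar>)"
        by (simp add: mult_exp_exp)
      finally show ?thesis
        using exp_le_quadratic_plus_cubic[of "t * Y x"] t
        by (simp add: B_def abs_mult power_mult_distrib)
    qed
    have intB: "integrable M B"
      unfolding B_def using intY int by (intro Bochner_Integration.integrable_add) auto
    have "(\<integral>\<^sup>+x. ennreal (exp (t * Y x)) \<partial>M) \<le> (\<integral>\<^sup>+x. ennreal (B x) \<partial>M)"
      using le by (intro nn_integral_mono ennreal_leI)
    also have "\<dots> = ennreal (expectation B)"
      using intB le order_trans[OF exp_ge_zero le] by (intro nn_integral_eq_integral) auto
    also have "expectation B = 1 + t\<^sup>2 / 2 * (v - \<delta>) + t\<^sup>2 * (t * K)"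
      unfolding B_def using intY int mean
      by (simp add: \<delta>_def E_def K_def prob_space power2_eq_square power3_eq_cube algebra_simps)
    also have "\<dots> \<le> 1 + t\<^sup>2 / 2 * (v - \<delta>) + t\<^sup>2 * (\<delta> / 2)"
      using t by (intro add_left_mono mult_left_mono) auto
    also have "\<dots> = 1 + t\<^sup>2 * v / 2" by (simp add: field_simps)
    also have "\<dots> \<le> exp (t\<^sup>2 * v / 2)" by (rule exp_ge_add_one_self)
    finally show ?thesis by (simp add: ennreal_leI)
  qed
  \<comment> \<open>Dividing by \<open>K + 1\<close> rather than \<open>K\<close> keeps the
    denominator positive.\<close>
  define t0 where "t0 = min (s / 2) (\<delta> / 2 / (K + 1))"
  have "0 < t0" using s \<delta> K by (simp add: t0_def)
  moreover have "t * K \<le> \<delta> / 2" if "0 \<le> t" "t \<le> t0" for t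
  proof -
    have "t * K \<le> t * (K + 1)" using that by (intro mult_left_mono) auto
    also have "\<dots> \<le> \<delta> / 2 / (K + 1) * (K + 1)"
      using that K by (intro mult_right_mono) (auto simp: t0_def)
    also have "\<dots> = \<delta> / 2" using K by (intro nonzero_eq_divide_eq[THEN iffD1]) auto
    finally show ?thesis .
  qed
  ultimately show ?thesis
    using bound by (intro exI[of _ t0]) (auto simp: t0_def)
qed

section \<open>Chernoff bounds for independent samples\<close>

locale iid_sample = prob_space M for M :: "'a measure" +
  fixes X :: "nat \<Rightarrow> 'a \<Rightarrow> real" and P :: "real measure"
  assumes indep: "indep_vars (\<lambda>_. borel) X {1..}"
    and law: "\<And>j. 1 \<le> j \<Longrightarrow> distr M borel (X j) = P"
begin

lemma measurable_X [measurable]: "1 \<le> j \<Longrightarrow> X j \<in> borel_measurable M"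
  using indep by (auto simp: indep_vars_def)

lemma sets_law [simp, measurable_cong]: "sets P = sets borel"
  using law[of 1] by (metis order_refl sets_distr)

lemma prob_space_law: "prob_space P"
  using prob_space_distr[of "X 1" borel] law[of 1] by simp

text \<open>Markov's inequality for the exponential of the sum; independence factors its expectation
  into \<open>n\<close> copies of the integral under the common law. Nonnegative integrals spare
  integrability conditions.\<close>

lemma chernoff_sum:
  assumes [measurable]: "g \<in> borel_measurable borel" and t: "0 < t" and K: "0 \<le> K"
    and mgf: "(\<integral>\<^sup>+x. ennreal (exp (t * g x)) \<partial>P) \<le> ennreal K"
  shows "prob {\<omega> \<in> space M. (\<Sum>j=1..n. g (X j \<omega>)) \<ge> c} \<le> exp (- t * c) * K ^ n"
proof -
  have [measurable]: "(\<lambda>\<omega>. \<Sum>j=1..n. g (X j \<omega>)) \<in> borel_measurable M"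
    by (intro borel_measurable_sum measurable_compose[OF measurable_X]) auto
  have "ennreal (prob {\<omega> \<in> space M. (\<Sum>j=1..n. g (X j \<omega>)) \<ge> c})
      = emeasure M {\<omega> \<in> space M. (\<Sum>j=1..n. g (X j \<omega>)) \<ge> c}"
    by (simp add: emeasure_eq_measure)
  also have "\<dots> \<le> ennreal (exp (- t * c)) * (\<integral>\<^sup>+x\<in>space M. exp (t * (\<Sum>j=1..n. g (X j x))) \<partial>M)"
    by (intro Chernoff_ineq_nn_integral_ge t) auto
  also have "(\<integral>\<^sup>+x\<in>space M. exp (t * (\<Sum>j=1..n. g (X j x))) \<partial>M)
      = (\<integral>\<^sup>+x. (\<Prod>j=1..n. ennreal (exp (t * g (X j x)))) \<partial>M)"
    by (intro nn_integral_cong) (simp_all add: sum_distrib_left exp_sum prod_ennreal)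
  also have "\<dots> = (\<Prod>j=1..n. \<integral>\<^sup>+x. ennreal (exp (t * g (X j x))) \<partial>M)"
    by (intro indep_vars_nn_integral indep_vars_compose2[OF indep_vars_subset[OF indep]]) auto
  also have "\<dots> = (\<Prod>j=1..n. \<integral>\<^sup>+x. ennreal (exp (t * g x)) \<partial>P)"
  proof (intro prod.cong refl)
    fix j assume "j \<in> {1..n}"
    then have j: "1 \<le> j" by simp
    show "(\<integral>\<^sup>+x. ennreal (exp (t * g (X j x))) \<partial>M) = (\<integral>\<^sup>+x. ennreal (exp (t * g x)) \<partial>P)"
      unfolding law[OF j, symmetric] using j by (subst nn_integral_distr) auto
  qed
  also have "\<dots> \<le> (\<Prod>j=1..n. ennreal K)"
    by (intro prod_mono_ennreal mgf)
  also have "ennreal (exp (- t * c)) * (\<Prod>j=1..n. ennreal K) = ennreal (exp (- t * c) * K ^ n)"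
    using K by (simp add: ennreal_power ennreal_mult)
  finally show ?thesis
    using K by (auto simp: mult_left_mono)
qed

text \<open>Chernoff's bound with the Gaussian estimate of the moment generating function. The range
  of \<open>r\<close> does not depend on \<open>n\<close>, as the later limit in \<open>n\<close> at
  fixed \<open>\<epsilon>\<close> requires.\<close>

lemma moderate_deviation_real:
  fixes g :: "real \<Rightarrow> real"
  assumes [measurable]: "g \<in> borel_measurable borel" and s: "0 < s"
    and int: "integrable P (\<lambda>x. exp (s * \<bar>g x\<bar>))"
    and mean: "(LINT x|P. g x) = 0" and var: "(LINT x|P. (g x)\<^sup>2) < v"
  shows "\<exists>r0>0. \<forall>r n. 0 < r \<and> r \<le> r0 \<longrightarrow>
    prob {\<omega> \<in> space M. (\<Sum>j=1..n. g (X j \<omega>)) \<ge> real n * r} \<le> exp (- real n * r\<^sup>2 / (2 * v))"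
proof -
  interpret P: prob_space P by (rule prob_space_law)
  have "0 \<le> (LINT x|P. (g x)\<^sup>2)" by simp
  then have v: "0 < v" using var by linarith
  obtain t0 where t0: "0 < t0" "\<And>t. 0 \<le> t \<Longrightarrow> t \<le> t0 \<Longrightarrow>
      (\<integral>\<^sup>+x. ennreal (exp (t * g x)) \<partial>P) \<le> ennreal (exp (t\<^sup>2 * v / 2))"
    using P.exponential_moment_le_gaussian[OF _ s int mean var] by auto
  have "prob {\<omega> \<in> space M. (\<Sum>j=1..n. g (X j \<omega>)) \<ge> real n * r} \<le> exp (- real n * r\<^sup>2 / (2 * v))"
    if r: "0 < r" "r \<le> v * t0" for r n
  proof -
    \<comment> \<open>The minimizer of the exponent \<open>- t * r + t\<^sup>2 * v / 2\<close>;
      \<open>r \<le> v * t0\<close> keeps it in the admissible range.\<close>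
    define t where "t = r / v"
    have t: "0 < t" "t \<le> t0" using r v by (auto simp: t_def field_simps)
    have "prob {\<omega> \<in> space M. (\<Sum>j=1..n. g (X j \<omega>)) \<ge> real n * r}
        \<le> exp (- t * (real n * r)) * exp (t\<^sup>2 * v / 2) ^ n"
      using t t0(2)[of t] by (intro chernoff_sum) auto
    also have "\<dots> = exp (- t * (real n * r) + real n * (t\<^sup>2 * v / 2))"
      unfolding exp_add exp_of_nat_mult ..
    also have "- t * (real n * r) + real n * (t\<^sup>2 * v / 2) = - real n * r\<^sup>2 / (2 * v)"
      using v by (simp add: t_def field_simps power2_eq_square)
    finally show ?thesis .
  qed
  then show ?thesis
    using t0(1) v by (intro exI[of _ "v * t0"]) auto
qed

end

text \<open>By compactness, finitely many of the sets where the projection on \<open>u\<close>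
  exceeds \<open>\<kappa>\<close> cover the unit circle. This reduces a modulus to finitely many
  real components at the cost of a factor \<open>\<kappa>\<close> as close to one as
  desired.\<close>

lemma finite_direction_net:
  assumes "\<kappa> < 1"
  shows "\<exists>D. finite D \<and> (\<forall>u\<in>D. norm u = 1) \<and> (\<forall>w::complex. \<exists>u\<in>D. \<kappa> * norm w \<le> Re (u * w))"
proof -
  define V where "V u = {w. \<kappa> < Re (cnj u * w)}" for u
  have "open (V u)" for u
    unfolding V_def by (intro open_Collect_less continuous_intros)
  moreover have "sphere 0 1 \<subseteq> \<Union>(V ` sphere 0 1)"
  proof
    fix u :: complex assume u: "u \<in> sphere 0 1"
    then have "cnj u * u = 1"
      using complex_norm_square[of u] by (simp add: mult.commute)
    then have "u \<in> V u" using assms by (simp only: V_def mem_Collect_eq one_complex.sel)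
    then show "u \<in> \<Union>(V ` sphere 0 1)" using u by blast
  qed
  ultimately obtain D where D: "D \<subseteq> sphere 0 1" "finite D" "sphere 0 1 \<subseteq> \<Union>(V ` D)"
    using compactE_image[OF compact_sphere[of "0::complex" 1], of "sphere 0 1" V] by metis
  \<comment> \<open>The net is conjugated because \<open>V u\<close> is defined by
    \<open>cnj u * w\<close>.\<close>
  have "\<exists>u\<in>cnj ` D. \<kappa> * norm w \<le> Re (u * w)" for w
  proof (cases "w = 0")
    case True
    \<comment> \<open>For \<open>w = 0\<close> any direction works; covering the point 1 shows that
      there is one.\<close>
    have "(1::complex) \<in> sphere 0 1" by simp
    then show ?thesis using True D(3) by auto
  next
    case False
    then have "w / norm w \<in> sphere 0 1" by (simp add: norm_divide)
    then obtain u where u: "u \<in> D" "\<kappa> < Re (cnj u * (w / norm w))"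
      using D(3) unfolding V_def by blast
    have "Re (cnj u * (w / norm w)) = Re (cnj u * w) / norm w"
      by (metis Re_divide_of_real times_divide_eq_right)
    then show ?thesis using u False by (auto simp: field_simps intro!: bexI[of _ u])
  qed
  then show ?thesis
    using D by (intro exI[of _ "cnj ` D"]) auto
qed

section \<open>From real to complex summands\<close>

context iid_sample
begin

text \<open>A union bound over a net of directions, to each of which the real estimate applies; the
  prefactor is the size of the net. The strict inequality in \<open>2 * v * \<rho> < 1\<close>
  leaves room for the loss \<open>\<kappa>\<close>.\<close>

theorem moderate_deviation_complex:
  fixes g :: "real \<Rightarrow> complex"
  assumes [measurable]: "g \<in> borel_measurable borel" and s: "0 < s"
    and int: "integrable P (\<lambda>x. exp (s * norm (g x)))"
    and mean: "(LINT x|P. g x) = 0"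
    and var: "\<And>u. norm u = 1 \<Longrightarrow> (LINT x|P. (Re (u * g x))\<^sup>2) \<le> v"
    and rate: "0 < \<rho>" "2 * v * \<rho> < 1"
  shows "\<exists>C\<ge>0. \<exists>r0>0. \<forall>r n. 0 < r \<and> r \<le> r0 \<longrightarrow>
    prob {\<omega> \<in> space M. norm (\<Sum>j=1..n. g (X j \<omega>)) \<ge> real n * r} \<le> C * exp (- real n * \<rho> * r\<^sup>2)"
proof -
  interpret P: prob_space P by (rule prob_space_law)
  have "0 \<le> (LINT x|P. (Re (1 * g x))\<^sup>2)" by simp
  also have "\<dots> \<le> v" by (rule var) simp
  finally have v0: "0 \<le> v" .
  \<comment> \<open>\<open>v'\<close> exceeds every directional variance strictly, as the real
    estimate demands, while \<open>\<kappa>\<close> below is chosen so that threshold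
    \<open>\<kappa> * r\<close> yields exactly the rate \<open>\<rho>\<close>.\<close>
  obtain v' where v': "v < v'" "v' < 1 / (2 * \<rho>)"
    using dense[of v "1 / (2 * \<rho>)"] rate by (auto simp: field_simps)
  define \<kappa> where "\<kappa> = sqrt (2 * v' * \<rho>)"
  have pos: "0 < 2 * v' * \<rho>" "2 * v' * \<rho> < 1"
    using v' v0 rate by (auto simp: field_simps)
  then have \<kappa>: "0 < \<kappa>" "\<kappa> < 1" "\<kappa>\<^sup>2 / (2 * v') = \<rho>"
    using v' v0 by (auto simp: \<kappa>_def)
  obtain D where D: "finite D" "\<And>u. u \<in> D \<Longrightarrow> norm u = 1" "\<And>w. \<exists>u\<in>D. \<kappa> * norm w \<le> Re (u * w)"
    using finite_direction_net[OF \<kappa>(2)] by blast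
  have intg: "integrable P g"
  proof (rule Bochner_Integration.integrable_bound)
    show "integrable P (\<lambda>x. norm (g x) ^ 1)"
      by (rule integrable_power_of_exponential_moment[OF _ s]) (use int in auto)
  qed auto
  have "\<forall>u\<in>D. \<exists>R>0. \<forall>r n. 0 < r \<and> r \<le> R \<longrightarrow>
      prob {\<omega> \<in> space M. (\<Sum>j=1..n. Re (u * g (X j \<omega>))) \<ge> real n * r} \<le> exp (- real n * r\<^sup>2 / (2 * v'))"
  proof (rule ballI, rule moderate_deviation_real[OF _ s])
    fix u assume u: "u \<in> D"
    have le: "\<bar>Re (u * g x)\<bar> \<le> norm (g x)" for x
      using abs_Re_le_cmod[of "u * g x"] D(2)[OF u] by (simp add: norm_mult)
    show "integrable P (\<lambda>x. exp (s * \<bar>Re (u * g x)\<bar>))"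
      by (rule Bochner_Integration.integrable_bound[OF int]) (use le s in \<open>auto intro!: AE_I2\<close>)
    have "(LINT x|P. Re (u * g x)) = Re (LINT x|P. u * g x)"
      using intg by (intro integral_Re) auto
    then show "(LINT x|P. Re (u * g x)) = 0" by (simp add: mean)
    show "(LINT x|P. (Re (u * g x))\<^sup>2) < v'"
      using var[OF D(2)[OF u]] v' by simp
  qed measurable
  from bchoice[OF this] obtain R where "\<forall>u\<in>D. 0 < R u \<and> (\<forall>r n. 0 < r \<and> r \<le> R u \<longrightarrow>
      prob {\<omega> \<in> space M. (\<Sum>j=1..n. Re (u * g (X j \<omega>))) \<ge> real n * r} \<le> exp (- real n * r\<^sup>2 / (2 * v')))"
    by blast
  then have R: "\<And>u. u \<in> D \<Longrightarrow> 0 < R u" "\<And>u r n. u \<in> D \<Longrightarrow> 0 < r \<Longrightarrow> r \<le> R u \<Longrightarrow>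
      prob {\<omega> \<in> space M. (\<Sum>j=1..n. Re (u * g (X j \<omega>))) \<ge> real n * r} \<le> exp (- real n * r\<^sup>2 / (2 * v'))"
    by blast+
  \<comment> \<open>The element 1 keeps the set nonempty for \<open>Min\<close>.\<close>
  define r0 where "r0 = Min (insert 1 (R ` D))"
  have r0: "0 < r0" "\<And>u. u \<in> D \<Longrightarrow> r0 \<le> R u"
    using D(1) R(1) by (auto simp: r0_def)
  have "prob {\<omega> \<in> space M. norm (\<Sum>j=1..n. g (X j \<omega>)) \<ge> real n * r} \<le> real (card D) * exp (- real n * \<rho> * r\<^sup>2)"
    if r: "0 < r" "r \<le> r0" for r n
  proof -
    define A where "A u = {\<omega> \<in> space M. (\<Sum>j=1..n. Re (u * g (X j \<omega>))) \<ge> real n * (\<kappa> * r)}" for u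
    have [measurable]: "(\<lambda>\<omega>. \<Sum>j=1..n. Re (u * g (X j \<omega>))) \<in> borel_measurable M" for u
      by (intro borel_measurable_sum measurable_compose[OF measurable_X]) auto
    have A: "A u \<in> events" for u unfolding A_def by measurable
    have "{\<omega> \<in> space M. norm (\<Sum>j=1..n. g (X j \<omega>)) \<ge> real n * r} \<subseteq> (\<Union>u\<in>D. A u)"
    proof
      fix \<omega> assume \<omega>: "\<omega> \<in> {\<omega> \<in> space M. norm (\<Sum>j=1..n. g (X j \<omega>)) \<ge> real n * r}"
      obtain u where u: "u \<in> D" "\<kappa> * norm (\<Sum>j=1..n. g (X j \<omega>)) \<le> Re (u * (\<Sum>j=1..n. g (X j \<omega>)))"
        using D(3) by blast
      have "real n * (\<kappa> * r) = \<kappa> * (real n * r)" by simp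
      also have "\<dots> \<le> \<kappa> * norm (\<Sum>j=1..n. g (X j \<omega>))"
        using \<omega> \<kappa> by (intro mult_left_mono) auto
      also note u(2)
      finally show "\<omega> \<in> (\<Union>u\<in>D. A u)"
        using u(1) \<omega> by (auto simp: A_def sum_distrib_left Re_sum)
    qed
    then have "prob {\<omega> \<in> space M. norm (\<Sum>j=1..n. g (X j \<omega>)) \<ge> real n * r} \<le> prob (\<Union>u\<in>D. A u)"
      using A D(1) by (intro finite_measure_mono) auto
    also have "\<dots> \<le> (\<Sum>u\<in>D. prob (A u))"
      using A D(1) by (intro finite_measure_subadditive_finite) auto
    also have "\<dots> \<le> (\<Sum>u\<in>D. exp (- real n * \<rho> * r\<^sup>2))"
    proof (rule sum_mono)
      fix u assume u: "u \<in> D"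
      have "\<kappa> * r \<le> R u"
        using r r0(2)[OF u] \<kappa> mult_left_le_one_le[of r \<kappa>] by linarith
      then have "prob (A u) \<le> exp (- real n * (\<kappa> * r)\<^sup>2 / (2 * v'))"
        unfolding A_def using u r \<kappa> by (intro R(2)) auto
      also have "- real n * (\<kappa> * r)\<^sup>2 / (2 * v') = - real n * (\<kappa>\<^sup>2 / (2 * v')) * r\<^sup>2"
        by (simp add: power_mult_distrib)
      finally show "prob (A u) \<le> exp (- real n * \<rho> * r\<^sup>2)" by (simp add: \<kappa>(3))
    qed
    finally show ?thesis by simp
  qed
  then show ?thesis
    using r0(1) by (intro exI[of _ "real (card D)"]) auto
qed

end

section \<open>The Kullback--Leibler bound\<close>

lemma integral_cauchy_density:
  assumes "0 < Im \<theta>"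
  shows "(LINT x|lborel. cauchy_density \<theta> x) = 1"
proof -
  have "(LINT x|lborel. complex_of_real (cauchy_density \<theta> x)) = 1"
    using cauchy_mean_bounded_holomorphic[OF assms, of "\<lambda>_. 1" 1] by (simp add: scaleR_conv_of_real)
  then show ?thesis by (simp flip: of_real_eq_iff)
qed

text \<open>Gibbs' inequality: \<open>ln x \<le> x - 1\<close> bounds the integrand below by the
  difference of two densities of equal mass.\<close>

lemma cauchy_KL_nonneg:
  assumes "0 < Im \<theta>" "0 < Im \<theta>'"
  shows "0 \<le> cauchy_KL \<theta>' \<theta>"
proof -
  let ?p = "cauchy_density \<theta>" and ?q = "cauchy_density \<theta>'"
  have pos: "0 < ?p x" "0 < ?q x" for x
    using assms by (auto intro!: cauchy_density_pos simp: upper_half_plane_def)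
  have "0 \<le> (LINT x|lborel. ?q x * ln (?q x / ?p x))"
  proof (cases "integrable lborel (\<lambda>x. ?q x * ln (?q x / ?p x))")
    case True
    have "0 = (LINT x|lborel. ?q x - ?p x)"
      using assms by (simp add: integrable_cauchy_density integral_cauchy_density)
    also have "\<dots> \<le> (LINT x|lborel. ?q x * ln (?q x / ?p x))"
    proof (intro integral_mono True Bochner_Integration.integrable_diff integrable_cauchy_density assms)
      fix x
      have "ln (?p x / ?q x) \<le> ?p x / ?q x - 1"
        using pos[of x] by (intro ln_le_minus_one) auto
      then have "1 - ?p x / ?q x \<le> ln (?q x / ?p x)"
        using pos[of x] by (simp add: ln_div)
      then have "?q x * (1 - ?p x / ?q x) \<le> ?q x * ln (?q x / ?p x)"
        using pos(2)[of x] by (intro mult_left_mono) auto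
      then show "?q x - ?p x \<le> ?q x * ln (?q x / ?p x)"
        using pos(2)[of x] by (simp add: right_diff_distrib)
    qed
    finally show ?thesis .
  next
    \<comment> \<open>A Bochner integral that does not exist has value zero.\<close>
    case False
    then show ?thesis by (simp add: not_integrable_integral_eq)
  qed
  then show ?thesis
    using assms by (simp add: cauchy_KL_eq_integral upper_half_plane_def)
qed

text \<open>For a real translation the log-likelihood ratio is the boundary value of
  \<open>2 * Re (Ln w)\<close> with \<open>w\<close> holomorphic and close to one on the half plane,
  so the Poisson formula evaluates its mean at the shifted parameter.\<close>

lemma cauchy_KL_shift:
  assumes \<sigma>: "0 < Im \<theta>" and t: "0 \<le> t" "t \<le> Im \<theta> / 2"
  shows "cauchy_KL (\<theta> + of_real t) \<theta> = ln (1 + t\<^sup>2 / (4 * (Im \<theta>)\<^sup>2))"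
proof -
  define \<theta>' where "\<theta>' = \<theta> + of_real t"
  have \<theta>': "Im \<theta>' = Im \<theta>" "0 < Im \<theta>'" using \<sigma> by (auto simp: \<theta>'_def)
  \<comment> \<open>Zero and pole of \<open>w\<close> lie in the lower half plane, and on the real
    line its squared modulus is the ratio of the densities.\<close>
  define w where "w z = (z - cnj \<theta>) / (z - cnj \<theta>')" for z
  define L where "L z = Ln (w z)" for z
  have nz: "z - cnj \<theta>' \<noteq> 0" "z - cnj \<theta> \<noteq> 0" if "0 \<le> Im z" for z
    using that \<sigma> \<theta>' by (auto simp: complex_eq_iff)
  \<comment> \<open>A shift by at most half the distance to the pole keeps \<open>w\<close> in the
    right half plane, away from the branch cut of \<open>Ln\<close>.\<close>
  have w1: "norm (w z - 1) \<le> 1 / 2" if "0 \<le> Im z" for z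
  proof -
    have eq: "w z - 1 = of_real t / (z - cnj \<theta>')"
      using nz[OF that] by (simp add: w_def field_simps \<theta>'_def)
    have "Im \<theta> \<le> norm (z - cnj \<theta>')"
      using abs_Im_le_cmod[of "z - cnj \<theta>'"] that \<sigma> \<theta>' by simp
    then have "t / norm (z - cnj \<theta>') \<le> (Im \<theta> / 2) / Im \<theta>"
      using t \<sigma> by (intro frac_le) auto
    then show ?thesis unfolding eq norm_divide using t \<sigma> by simp
  qed
  have Re_w: "1 / 2 \<le> Re (w z)" if "0 \<le> Im z" for z
    using w1[OF that] abs_Re_le_cmod[of "w z - 1"] by simp
  have w_nonpos: "w z \<notin> \<real>\<^sub>\<le>\<^sub>0" if "0 \<le> Im z" for z
    using Re_w[OF that] by (auto simp: complex_nonpos_Reals_iff)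
  have contw: "continuous_on closed_upper_half_plane w"
    unfolding w_def using nz by (intro continuous_intros) (auto simp: closed_upper_half_plane_altdef)
  have contL: "continuous_on closed_upper_half_plane L"
    unfolding L_def using w_nonpos by (intro continuous_intros contw) (auto simp: closed_upper_half_plane_altdef)
  have holoL: "L holomorphic_on upper_half_plane"
    unfolding L_def w_def using w_nonpos nz
    by (intro holomorphic_intros) (auto simp: upper_half_plane_def w_def)
  \<comment> \<open>The modulus of \<open>w\<close> lies in \<open>[1/2, 3/2]\<close>, whence its
    logarithm is at most one in absolute value; the argument is at most \<open>pi\<close>.\<close>
  have boundL: "norm (L z) \<le> 1 + pi" if "0 \<le> Im z" for z
  proof -
    have nw: "1 / 2 \<le> norm (w z)" "norm (w z) \<le> 3 / 2"
      using w1[OF that] Re_w[OF that] abs_Re_le_cmod[of "w z"] norm_triangle_ineq2[of "w z" 1] by auto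
    then have "w z \<noteq> 0" by auto
    then have "norm (L z) \<le> \<bar>ln (norm (w z))\<bar> + pi"
      using Im_Ln_le_pi[of "w z"] mpi_less_Im_Ln[of "w z"] cmod_le[of "L z"]
      by (auto simp: L_def)
    moreover have "ln (norm (w z)) \<le> norm (w z) - 1" "ln (inverse (norm (w z))) \<le> inverse (norm (w z)) - 1"
      using nw by (auto intro!: ln_le_minus_one)
    moreover have "inverse (norm (w z)) \<le> 2"
      using nw le_imp_inverse_le[of "1/2" "norm (w z)"] by simp
    moreover have "ln (inverse (norm (w z))) = - ln (norm (w z))"
      using nw by (intro ln_inverse)
    ultimately show ?thesis using nw by linarith
  qed
  have mean: "(LINT x|lborel. cauchy_density \<theta>' x *\<^sub>R L (of_real x)) = L \<theta>'"
    by (rule cauchy_mean_bounded_holomorphic[OF \<theta>'(2) contL holoL boundL])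
  have int: "integrable lborel (\<lambda>x. cauchy_density \<theta>' x *\<^sub>R L (of_real x))"
    by (rule integrable_cauchy_density_scaleR[where B = "1 + pi"])
      (use \<theta>' boundL continuous_on_real_line_measurable[OF contL] in auto)
  have integrand: "cauchy_density \<theta>' x * ln (cauchy_density \<theta>' x / cauchy_density \<theta> x)
      = 2 * Re (cauchy_density \<theta>' x *\<^sub>R L (of_real x))" for x
  proof -
    have sq: "(norm (of_real x - cnj \<tau>))\<^sup>2 = (x - Re \<tau>)\<^sup>2 + (Im \<tau>)\<^sup>2" for \<tau>
      by (simp add: cmod_power2)
    have "w (of_real x) \<noteq> 0" using Re_w[of "of_real x"] by auto
    then have "2 * Re (L (of_real x)) = ln ((norm (w (of_real x)))\<^sup>2)"
      by (simp add: L_def ln_realpow)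
    also have "(norm (w (of_real x)))\<^sup>2 = cauchy_density \<theta>' x / cauchy_density \<theta> x"
      using \<sigma> unfolding w_def norm_divide power_divide sq cauchy_density_def \<theta>'(1) by simp
    finally show ?thesis by simp
  qed
  have "cauchy_KL \<theta>' \<theta> = 2 * Re (L \<theta>')"
    using \<sigma> \<theta>' integral_Re[OF int]
    by (simp add: cauchy_KL_eq_integral upper_half_plane_def integrand mean)
  also have "\<dots> = ln ((norm (w \<theta>'))\<^sup>2)"
  proof -
    have "w \<theta>' \<noteq> 0" using Re_w[of \<theta>'] \<theta>' by auto
    then show ?thesis by (simp add: L_def ln_realpow)
  qed
  also have "(norm (w \<theta>'))\<^sup>2 = 1 + t\<^sup>2 / (4 * (Im \<theta>)\<^sup>2)"
    unfolding w_def norm_divide power_divide cmod_power2 using \<sigma>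
    by (simp add: \<theta>'_def field_simps power2_eq_square)
  finally show ?thesis by (simp add: \<theta>'_def)
qed

text \<open>Real translations are competitors in the infimum, and \<open>ln (1 + x) \<le> x\<close>
  bounds their divergence.\<close>

lemma bahadur_bound_bounds:
  assumes \<sigma>: "0 < Im \<theta>" and \<epsilon>: "0 < \<epsilon>" "\<epsilon> < Im \<theta> / 2"
  shows "0 \<le> bahadur_bound \<epsilon> \<theta>" "bahadur_bound \<epsilon> \<theta> \<le> \<epsilon>\<^sup>2 / (4 * (Im \<theta>)\<^sup>2)"
proof -
  define K where "K = {cauchy_KL \<theta>' \<theta> |\<theta>'. \<theta>' \<in> upper_half_plane \<and> cmod (\<theta>' - \<theta>) > \<epsilon>}"
  have b: "bahadur_bound \<epsilon> \<theta> = Inf K" by (simp add: bahadur_bound_def K_def)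
  have nonneg: "0 \<le> k" if "k \<in> K" for k
    using that \<sigma> cauchy_KL_nonneg by (auto simp: K_def upper_half_plane_def)
  have mem: "cauchy_KL (\<theta> + of_real t) \<theta> \<in> K" if "\<epsilon> < t" for t
    using that \<sigma> \<epsilon> unfolding K_def by (intro CollectI exI[of _ "\<theta> + of_real t"]) (auto simp: upper_half_plane_def)
  then have "K \<noteq> {}" using \<epsilon> by (metis empty_iff)
  then show "0 \<le> bahadur_bound \<epsilon> \<theta>" unfolding b by (intro cInf_greatest nonneg)
  have le: "Inf K \<le> t\<^sup>2 / (4 * (Im \<theta>)\<^sup>2)" if t: "\<epsilon> < t" "t < Im \<theta> / 2" for t
  proof -
    have "Inf K \<le> cauchy_KL (\<theta> + of_real t) \<theta>"
      using mem[OF t(1)] nonneg by (intro cInf_lower) (auto intro!: bdd_belowI)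
    also have "\<dots> = ln (1 + t\<^sup>2 / (4 * (Im \<theta>)\<^sup>2))"
      using \<sigma> \<epsilon> t by (intro cauchy_KL_shift) auto
    also have "\<dots> \<le> t\<^sup>2 / (4 * (Im \<theta>)\<^sup>2)"
      by (rule ln_add_one_self_le_self) simp
    finally show ?thesis .
  qed
  show "bahadur_bound \<epsilon> \<theta> \<le> \<epsilon>\<^sup>2 / (4 * (Im \<theta>)\<^sup>2)"
    unfolding b
  \<comment> \<open>Competitors must be farther than \<open>\<epsilon>\<close> from
    \<open>\<theta>\<close>, so the value at \<open>\<epsilon>\<close> is reached as a limit of
    shifts \<open>t > \<epsilon>\<close>.\<close>
  proof (rule tendsto_lowerbound)
    show "((\<lambda>t. t\<^sup>2 / (4 * (Im \<theta>)\<^sup>2)) \<longlongrightarrow> \<epsilon>\<^sup>2 / (4 * (Im \<theta>)\<^sup>2)) (at_right \<epsilon>)"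
      using \<sigma> by (intro tendsto_intros) auto
    show "eventually (\<lambda>t. Inf K \<le> t\<^sup>2 / (4 * (Im \<theta>)\<^sup>2)) (at_right \<epsilon>)"
      using eventually_at_right_real[OF \<epsilon>(2)] by eventually_elim (auto intro: le)
  qed simp
qed

section \<open>The direction of an observation\<close>

text \<open>The Cayley transform of the half plane onto the unit disc with \<open>\<theta>\<close>
  sent to 0, restricted to the real line.\<close>

definition cauchy_direction :: "complex \<Rightarrow> real \<Rightarrow> complex" where
  "cauchy_direction \<theta> x = (of_real x - \<theta>) / (of_real x - cnj \<theta>)"

lemma norm_cauchy_direction:
  assumes "0 < Im \<theta>" shows "norm (cauchy_direction \<theta> x) = 1"
proof -
  have "norm (of_real x - \<theta>) = norm (cnj (of_real x - \<theta>))" by (simp only: complex_mod_cnj)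
  then have "norm (of_real x - \<theta>) = norm (of_real x - cnj \<theta>)" by simp
  moreover have "of_real x - cnj \<theta> \<noteq> 0" using assms by (auto simp: complex_eq_iff)
  ultimately show ?thesis by (simp add: cauchy_direction_def norm_divide)
qed

lemma measurable_cauchy_direction [measurable]: "cauchy_direction \<theta> \<in> borel_measurable borel"
  unfolding cauchy_direction_def[abs_def] by measurable

text \<open>Powers of the Cayley transform are bounded by one on the closed half plane and, for
  positive exponent, vanish at \<open>\<theta>\<close>; the Poisson formula applies.\<close>

lemma cauchy_mean_direction_power:
  assumes \<theta>: "0 < Im \<theta>" and k: "0 < k"
  shows "(LINT x|lborel. cauchy_density \<theta> x *\<^sub>R cauchy_direction \<theta> x ^ k) = 0"
proof -
  define F where "F z = ((z - \<theta>) / (z - cnj \<theta>)) ^ k" for z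
  have nz: "z - cnj \<theta> \<noteq> 0" if "0 \<le> Im z" for z
    using that \<theta> by (auto simp: complex_eq_iff)
  have "norm (F z) \<le> 1" if "0 \<le> Im z" for z
  proof -
    have "(Im z - Im \<theta>)\<^sup>2 \<le> (Im z + Im \<theta>)\<^sup>2"
      using that \<theta> by (intro abs_le_square_iff[THEN iffD1]) auto
    then have "norm (z - \<theta>) \<le> norm (z - cnj \<theta>)"
      by (simp add: cmod_def)
    then show ?thesis
      unfolding F_def norm_power norm_divide using nz[OF that]
      by (intro power_le_one) (auto simp: divide_le_eq_1)
  qed
  moreover have "continuous_on closed_upper_half_plane F" "F holomorphic_on upper_half_plane"
    unfolding F_def using nz
    by (auto intro!: continuous_intros holomorphic_intros simp: closed_upper_half_plane_altdef upper_half_plane_def)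
  ultimately have "(LINT x|lborel. cauchy_density \<theta> x *\<^sub>R F (complex_of_real x)) = F \<theta>"
    by (intro cauchy_mean_bounded_holomorphic[where B = 1] \<theta>)
  then show ?thesis
    using k by (simp add: F_def cauchy_direction_def)
qed

lemma
  fixes h :: "real \<Rightarrow> 'b :: {banach, second_countable_topology}"
  assumes "0 < Im \<theta>" and [measurable]: "h \<in> borel_measurable borel"
  shows integral_cauchy_distribution:
      "(LINT x|cauchy_distribution \<theta>. h x) = (LINT x|lborel. cauchy_density \<theta> x *\<^sub>R h x)"
    and integrable_cauchy_distribution:
      "integrable (cauchy_distribution \<theta>) h \<longleftrightarrow> integrable lborel (\<lambda>x. cauchy_density \<theta> x *\<^sub>R h x)"
proof -
  have "0 \<le> cauchy_density \<theta> x" for x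
    using cauchy_density_pos[of \<theta> x] assms(1) by (simp add: upper_half_plane_def)
  then show "(LINT x|cauchy_distribution \<theta>. h x) = (LINT x|lborel. cauchy_density \<theta> x *\<^sub>R h x)"
    "integrable (cauchy_distribution \<theta>) h \<longleftrightarrow> integrable lborel (\<lambda>x. cauchy_density \<theta> x *\<^sub>R h x)"
    unfolding cauchy_distribution_def by (simp_all add: integral_density integrable_density)
qed

lemma prob_space_cauchy_distribution:
  assumes "0 < Im \<theta>"
  shows "prob_space (cauchy_distribution \<theta>)"
proof
  have pos: "0 \<le> cauchy_density \<theta> x" for x
    using cauchy_density_pos[of \<theta> x] assms by (simp add: upper_half_plane_def)
  have "emeasure (cauchy_distribution \<theta>) (space (cauchy_distribution \<theta>))
      = (\<integral>\<^sup>+x. ennreal (cauchy_density \<theta> x) \<partial>lborel)"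
    by (simp add: cauchy_distribution_def emeasure_density)
  also have "\<dots> = 1"
    using nn_integral_eq_integral[OF integrable_cauchy_density[OF assms]] pos integral_cauchy_density[OF assms]
    by simp
  finally show "emeasure (cauchy_distribution \<theta>) (space (cauchy_distribution \<theta>)) = 1" .
qed

lemma sets_cauchy_distribution [simp, measurable_cong]: "sets (cauchy_distribution \<theta>) = sets borel"
  by (simp add: cauchy_distribution_def)

lemma mean_direction_power:
  assumes "0 < Im \<theta>" "0 < k"
  shows "(LINT x|cauchy_distribution \<theta>. cauchy_direction \<theta> x ^ k) = 0"
  by (subst integral_cauchy_distribution) (use assms cauchy_mean_direction_power in auto)

text \<open>On the unit circle \<open>(Re z)\<^sup>2 = 1 / 2 + Re (z\<^sup>2) / 2\<close>, and the
  square of the direction has mean zero.\<close>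

lemma variance_direction:
  assumes \<theta>: "0 < Im \<theta>" and u: "norm u = 1"
  shows "(LINT x|cauchy_distribution \<theta>. (Re (u * cauchy_direction \<theta> x))\<^sup>2) = 1 / 2"
proof -
  interpret prob_space "cauchy_distribution \<theta>" using \<theta> by (rule prob_space_cauchy_distribution)
  define h where "h x = u\<^sup>2 * cauchy_direction \<theta> x ^ 2" for x
  have int: "integrable (cauchy_distribution \<theta>) h"
    unfolding h_def
    by (rule integrable_const_bound[where B = 1])
      (auto simp: norm_mult norm_power norm_cauchy_direction \<theta> u)
  have "(LINT x|cauchy_distribution \<theta>. h x) = 0"
    unfolding h_def using mean_direction_power[OF \<theta>, of 2] by simp
  then have "(LINT x|cauchy_distribution \<theta>. Re (h x)) = 0"
    using integral_Re[OF int] by simp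
  then have "(LINT x|cauchy_distribution \<theta>. 1 / 2 + Re (h x) / 2) = 1 / 2"
    using integrable_Re[OF int] by (simp add: prob_space)
  moreover have "(Re (u * cauchy_direction \<theta> x))\<^sup>2 = 1 / 2 + Re (h x) / 2" for x
  proof -
    let ?z = "u * cauchy_direction \<theta> x"
    have "(Re ?z)\<^sup>2 + (Im ?z)\<^sup>2 = 1"
      using norm_cauchy_direction[OF \<theta>, of x] u by (simp only: cmod_power2[symmetric] norm_mult) simp
    moreover have "Re (?z\<^sup>2) = (Re ?z)\<^sup>2 - (Im ?z)\<^sup>2" by (simp only: Re_power2)
    ultimately have "(Re ?z)\<^sup>2 = 1 / 2 + Re (?z\<^sup>2) / 2" by linarith
    then show ?thesis by (simp only: power_mult_distrib h_def)
  qed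
  ultimately show ?thesis by presburger
qed

section \<open>Expansion of the one-step estimator\<close>

text \<open>The remainder is explicit: with \<open>b = x - cnj \<theta>\<close> it equals
  \<open>- (d - W * cnj d)\<^sup>2 / (b - cnj d)\<close>, where the numerator is at most
  \<open>(2 * norm d)\<^sup>2\<close> and the denominator at least \<open>Im \<theta> / 2\<close> in
  modulus.\<close>

lemma one_step_term_expansion:
  fixes x :: real and y \<theta> :: complex
  assumes \<theta>: "0 < Im \<theta>" and d: "norm (y - \<theta>) \<le> Im \<theta> / 2"
  defines "W \<equiv> cauchy_direction \<theta> x" and "d \<equiv> y - \<theta>"
  shows "norm (y + 2 * of_real (Im y) * \<i> * ((of_real x - y) / (of_real x - cnj y)) - \<theta>
      - ((2 * \<i> * of_real (Im \<theta>) + 2 * d) * W - cnj d * W\<^sup>2)) \<le> 8 * (norm d)\<^sup>2 / Im \<theta>"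
proof -
  define a b where "a = of_real x - \<theta>" and "b = of_real x - cnj \<theta>"
  have ab: "W = a / b" by (simp add: W_def cauchy_direction_def a_def b_def)
  have nb: "Im \<theta> \<le> norm b"
    using abs_Im_le_cmod[of b] \<theta> by (simp add: b_def)
  then have b: "b \<noteq> 0" using \<theta> by auto
  have dd: "norm d \<le> Im \<theta> / 2" using d by (simp add: d_def)
  have nbd: "Im \<theta> / 2 \<le> norm (b - cnj d)"
    using norm_triangle_ineq2[of b "cnj d"] nb dd by simp
  then have bd: "b - cnj d \<noteq> 0" using \<theta> by auto
  have e1: "of_real x - y = a - d" "of_real x - cnj y = b - cnj d" "y = \<theta> + d"
    by (simp_all add: a_def b_def d_def)
  have e2: "2 * of_real (Im y) * \<i> = (b - cnj d) - (a - d)" "2 * \<i> * of_real (Im \<theta>) = b - a"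
    by (simp_all add: a_def b_def d_def complex_eq_iff)
  have "y + 2 * of_real (Im y) * \<i> * ((of_real x - y) / (of_real x - cnj y)) - \<theta>
      - ((2 * \<i> * of_real (Im \<theta>) + 2 * d) * W - cnj d * W\<^sup>2)
      = d + ((b - cnj d) - (a - d)) * ((a - d) / (b - cnj d)) - ((b - a + 2 * d) * (a / b) - cnj d * (a / b)\<^sup>2)"
    unfolding e1(1,2) e2 ab by (simp add: d_def)
  also have "\<dots> = - ((d - W * cnj d)\<^sup>2 / (b - cnj d))"
    unfolding ab using b bd by (simp add: divide_simps) (simp add: power2_eq_square algebra_simps)
  also have "norm \<dots> \<le> (norm d + norm d)\<^sup>2 / (Im \<theta> / 2)"
  proof -
    have "norm (d - W * cnj d) \<le> norm d + norm d"
      using norm_triangle_ineq4[of d "W * cnj d"] norm_cauchy_direction[OF \<theta>, of x]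
      by (simp add: norm_mult W_def)
    then show ?thesis
      unfolding norm_minus_cancel norm_divide norm_power using nbd \<theta>
      by (intro frac_le power_mono) auto
  qed
  also have "\<dots> = 8 * (norm d)\<^sup>2 / Im \<theta>"
    by (simp add: power2_eq_square field_simps)
  finally show ?thesis .
qed

text \<open>The termwise expansion is averaged. When \<open>\<delta>\<close>, \<open>r\<close> and
  \<open>s\<close> are all of order \<open>\<epsilon>\<close>, only
  \<open>2 * Im \<theta> * r\<close> is of first order.\<close>

lemma one_step_estimator_error:
  fixes x :: "nat \<Rightarrow> real" and f :: "complex \<Rightarrow> complex" and U :: "complex set"
  assumes \<theta>: "0 < Im \<theta>" and n: "0 < n"
  defines "y \<equiv> quasi_arithmetic_mean U f n x"
  assumes d: "norm (y - \<theta>) \<le> \<delta>" "\<delta> \<le> Im \<theta> / 2"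
    and S1: "norm (\<Sum>j=1..n. cauchy_direction \<theta> (x j)) \<le> real n * r"
    and S2: "norm (\<Sum>j=1..n. cauchy_direction \<theta> (x j) ^ 2) \<le> real n * s"
  shows "norm (one_step_estimator U f n x - \<theta>) \<le> (2 * Im \<theta> + 2 * \<delta>) * r + \<delta> * s + 8 * \<delta>\<^sup>2 / Im \<theta>"
proof -
  define W where "W j = cauchy_direction \<theta> (x j)" for j
  define T where "T j = y + 2 * of_real (Im y) * \<i> * ((of_real (x j) - y) / (of_real (x j) - cnj y)) - \<theta>" for j
  define A where "A j = (2 * \<i> * of_real (Im \<theta>) + 2 * (y - \<theta>)) * W j - cnj (y - \<theta>) * (W j)\<^sup>2" for j
  have \<delta>: "0 \<le> \<delta>" using d(1) norm_ge_zero[of "y - \<theta>"] by linarith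
  have "of_nat n * (y + c / of_nat n * (\<Sum>j=1..n. q j) - \<theta>) = (\<Sum>j=1..n. y + c * q j - \<theta>)" for c q
    using n by (simp add: sum.distrib sum_subtractf right_diff_distrib distrib_left flip: sum_distrib_left)
  then have "of_nat n * (one_step_estimator U f n x - \<theta>) = (\<Sum>j=1..n. T j)"
    unfolding T_def one_step_estimator_def y_def[symmetric] Let_def .
  then have "of_nat n * (one_step_estimator U f n x - \<theta>) = (\<Sum>j=1..n. T j - A j) + (\<Sum>j=1..n. A j)"
    by (simp add: sum_subtractf)
  then have "real n * norm (one_step_estimator U f n x - \<theta>) \<le> norm (\<Sum>j=1..n. T j - A j) + norm (\<Sum>j=1..n. A j)"
    by (metis norm_mult norm_of_nat norm_triangle_ineq)
  also have "norm (\<Sum>j=1..n. T j - A j) \<le> (\<Sum>j=1..n. 8 * \<delta>\<^sup>2 / Im \<theta>)"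
  proof (rule sum_norm_le)
    fix j
    have "norm (T j - A j) \<le> 8 * (norm (y - \<theta>))\<^sup>2 / Im \<theta>"
      unfolding T_def A_def W_def by (rule one_step_term_expansion) (use \<theta> d in auto)
    also have "\<dots> \<le> 8 * \<delta>\<^sup>2 / Im \<theta>"
      using d \<theta> by (intro divide_right_mono mult_left_mono power_mono) auto
    finally show "norm (T j - A j) \<le> 8 * \<delta>\<^sup>2 / Im \<theta>" .
  qed
  also have "norm (\<Sum>j=1..n. A j) \<le> (2 * Im \<theta> + 2 * \<delta>) * (real n * r) + \<delta> * (real n * s)"
  proof -
    have "(\<Sum>j=1..n. A j) = (2 * \<i> * of_real (Im \<theta>) + 2 * (y - \<theta>)) * (\<Sum>j=1..n. W j)
        - cnj (y - \<theta>) * (\<Sum>j=1..n. (W j)\<^sup>2)"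
      unfolding A_def by (simp add: sum_subtractf sum_distrib_left)
    also have "norm \<dots> \<le> norm (2 * \<i> * of_real (Im \<theta>) + 2 * (y - \<theta>)) * norm (\<Sum>j=1..n. W j)
        + norm (cnj (y - \<theta>)) * norm (\<Sum>j=1..n. (W j)\<^sup>2)"
      unfolding norm_mult[symmetric] by (rule norm_triangle_ineq4)
    also have "\<dots> \<le> (2 * Im \<theta> + 2 * \<delta>) * (real n * r) + \<delta> * (real n * s)"
    proof (intro add_mono mult_mono)
      have "norm (2 * \<i> * of_real (Im \<theta>) + 2 * (y - \<theta>)) \<le> norm (2 * \<i> * of_real (Im \<theta>)) + norm (2 * (y - \<theta>))"
        by (rule norm_triangle_ineq)
      also have "\<dots> \<le> 2 * Im \<theta> + 2 * \<delta>"
        using \<theta> d(1) by (simp only: norm_mult) simp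
      finally show "norm (2 * \<i> * of_real (Im \<theta>) + 2 * (y - \<theta>)) \<le> 2 * Im \<theta> + 2 * \<delta>" .
      show "norm (cnj (y - \<theta>)) \<le> \<delta>" using d(1) by (simp only: complex_mod_cnj)
    qed (use S1 S2 \<theta> \<delta> in \<open>auto simp: W_def\<close>)
    finally show ?thesis .
  qed
  finally have "real n * norm (one_step_estimator U f n x - \<theta>)
      \<le> real n * ((2 * Im \<theta> + 2 * \<delta>) * r + \<delta> * s + 8 * \<delta>\<^sup>2 / Im \<theta>)"
    by (simp add: algebra_simps)
  then show ?thesis using n by simp
qed

text \<open>An injective holomorphic function has an open image and a holomorphic inverse, whose
  differentiability at \<open>f z\<close> gives a Lipschitz estimate with constant
  \<open>norm (deriv g (f z)) + 1\<close>.\<close>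

lemma inv_into_holomorphic_lipschitz:
  assumes U: "open U" "inj_on f U" "f holomorphic_on U" and z: "z \<in> U"
  shows "\<exists>L\<ge>0. \<exists>\<rho>>0. \<forall>w. norm (w - f z) < \<rho> \<longrightarrow> norm (inv_into U f w - z) \<le> L * norm (w - f z)"
proof -
  obtain g where g: "g holomorphic_on (f ` U)" "\<And>z. z \<in> U \<Longrightarrow> g (f z) = z"
    using holomorphic_has_inverse[OF U(3,1,2)] by metis
  have opn: "open (f ` U)"
    using open_mapping_thm3[OF U(3,1,2)] .
  have eq: "inv_into U f w = g w" if "w \<in> f ` U" for w
    using that g(2) U(2) by auto
  have "(g has_field_derivative deriv g (f z)) (at (f z))"
    using g(1) opn z holomorphic_derivI by blast
  then obtain \<rho>1 where \<rho>1: "0 < \<rho>1" "\<And>w. norm (w - f z) < \<rho>1 \<Longrightarrow>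
      norm (g w - g (f z) - deriv g (f z) * (w - f z)) \<le> 1 * norm (w - f z)"
    unfolding has_field_derivative_def has_derivative_at_alt using zero_less_one by blast
  \<comment> \<open>Inside this radius \<open>w\<close> stays in the image of \<open>f\<close>,
    where \<open>inv_into U f\<close> is the holomorphic inverse.\<close>
  obtain \<rho>2 where \<rho>2: "0 < \<rho>2" "ball (f z) \<rho>2 \<subseteq> f ` U"
    using opn z open_contains_ball by (metis imageI)
  have "norm (inv_into U f w - z) \<le> (norm (deriv g (f z)) + 1) * norm (w - f z)"
    if w: "norm (w - f z) < min \<rho>1 \<rho>2" for w
  proof -
    have "w \<in> f ` U" using w \<rho>2(2) by (auto simp: dist_norm norm_minus_commute)
    have "norm (g w - z) \<le> norm (g w - z - deriv g (f z) * (w - f z)) + norm (deriv g (f z) * (w - f z))"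
      using norm_triangle_ineq[of "g w - z - deriv g (f z) * (w - f z)" "deriv g (f z) * (w - f z)"] by simp
    moreover have "norm (g w - z - deriv g (f z) * (w - f z)) \<le> norm (w - f z)"
      using \<rho>1(2)[of w] w g(2)[OF z] by simp
    ultimately show ?thesis
      unfolding eq[OF \<open>w \<in> f ` U\<close>] distrib_right mult_1 norm_mult[symmetric] by linarith
  qed
  then show ?thesis
    using \<rho>1(1) \<rho>2(1)
    by (intro exI[of _ "norm (deriv g (f z)) + 1"] conjI exI[of _ "min \<rho>1 \<rho>2"]) auto
qed

section \<open>The tail of the one-step estimator\<close>

lemma eventually_mult_less_at_right_0:
  fixes c r :: real
  assumes "0 < r"
  shows "eventually (\<lambda>\<epsilon>. c * \<epsilon> < r) (at_right 0)"
proof -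
  have "((\<lambda>\<epsilon>. c * \<epsilon>) \<longlongrightarrow> c * 0) (at_right 0)"
    by (intro tendsto_intros)
  then show ?thesis
    using assms order_tendstoD(2) by fastforce
qed

text \<open>On the real line \<open>f\<close> is continuous off \<open>Re a\<close>, and the value
  at one point does not affect measurability.\<close>

lemma measurable_generator_on_reals:
  assumes "open U" "closed_upper_half_plane - {a} \<subseteq> U" "f holomorphic_on U"
  shows "(\<lambda>x. f (complex_of_real x)) \<in> borel_measurable borel"
proof -
  have "complex_of_real x \<in> U" if "x \<noteq> Re a" for x
  proof -
    have "complex_of_real x \<noteq> a" using that by auto
    then show ?thesis using assms(2) by (auto simp: closed_upper_half_plane_altdef)
  qed
  then have "continuous_on (- {Re a}) (\<lambda>x. f (complex_of_real x))"
    by (intro continuous_on_compose2[OF holomorphic_on_imp_continuous_on[OF assms(3)]] continuous_intros) auto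
  then have "(\<lambda>x. indicator (- {Re a}) x *\<^sub>R f (complex_of_real x)) \<in> borel_measurable borel"
    by (intro borel_measurable_continuous_on_indicator) auto
  then show ?thesis
    by (rule measurable_discrete_difference[where X = "{Re a}"]) (auto simp: indicator_def)
qed

lemma three_exponentials_le:
  fixes a1 a2 a3 :: real
  assumes "0 \<le> C1" "0 \<le> C2" "0 \<le> C3" "b \<le> a1" "b \<le> a2" "b \<le> a3"
  shows "C1 * exp (- a1) + C2 * exp (- a2) + C3 * exp (- a3) \<le> (C1 + C2 + C3) * exp (- b)"
  using assms unfolding distrib_right by (intro add_mono mult_left_mono) auto

text \<open>The numerator is negative, so enlarging the denominator enlarges the quotient. For
  \<open>B = 0\<close> or \<open>p = 0\<close> the quotient is \<open>- \<infinity>\<close>.\<close>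

lemma ereal_ln_divide_le:
  assumes p: "0 \<le> p" "p \<le> exp (- q)" and q: "0 < q" and B: "0 \<le> B" "B \<le> B'" "0 < B'"
  shows "ereal_ln p / ereal B \<le> ereal (- q / B')"
proof (cases "p = 0")
  case True
  then show ?thesis
    using B by (cases "B = 0") (auto simp: ereal_ln_def divide_ereal_def)
next
  case False
  then have "ln p \<le> ln (exp (- q))"
    using p by (subst ln_le_cancel_iff) auto
  then have ln: "ln p \<le> - q" by simp
  show ?thesis
  proof (cases "B = 0")
    case True
    then show ?thesis
      using False ln q by (simp add: ereal_ln_def divide_ereal_def)
  next
    case B0: False
    then have "0 < B" using B by simp
    have "ln p / B \<le> - q / B"
      using ln \<open>0 < B\<close> by (intro divide_right_mono) auto
    also have "- q / B \<le> - q / B'"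
      using q B \<open>0 < B\<close> by (simp add: divide_left_mono)
    finally show ?thesis
      using False B0 by (simp add: ereal_ln_def)
  qed
qed

lemma (in prob_space) iid_sample_cauchy:
  assumes "indep_vars (\<lambda>_. borel) X {1..}"
    and "\<And>j. 1 \<le> j \<Longrightarrow> distributed M lborel (X j) (cauchy_density \<theta>)"
  shows "iid_sample M X (cauchy_distribution \<theta>)"
proof
  fix j :: nat assume "1 \<le> j"
  from distributed_distr_eq_density[OF assms(2)[OF this]]
  show "distr M borel (X j) = cauchy_distribution \<theta>"
    by (simp add: cauchy_distribution_def cong: distr_cong)
qed fact

section \<open>Exponential bound for the error probability\<close>

context iid_sample
begin

text \<open>A union bound over three events: the sample means of \<open>W\<close>,
  \<open>W\<^sup>2\<close> and \<open>g\<close> exceed \<open>c1 * \<epsilon>\<close>,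
  \<open>c2 * \<epsilon>\<close> and \<open>c3 * \<epsilon>\<close>. Outside them the error is at
  most \<open>\<epsilon> * (q + K * \<epsilon>) < \<epsilon>\<close>.\<close>

lemma one_step_estimator_tail:
  assumes \<theta>: "0 < Im \<theta>" and P: "P = cauchy_distribution \<theta>"
    and adm: "admissible_generator U f"
    and s: "0 < s" and int: "integrable M (\<lambda>\<omega>. exp (s * cmod (f (complex_of_real (X 1 \<omega>)))))"
    and \<eta>: "0 < \<eta>" "\<eta> < 1"
  shows "eventually (\<lambda>\<epsilon>. \<exists>C\<ge>0. \<forall>n\<ge>1.
    prob {\<omega> \<in> space M. cmod (one_step_estimator U f n (\<lambda>j. X j \<omega>) - \<theta>) > \<epsilon>}
      \<le> C * exp (- real n * ((1 - \<eta>) * (\<epsilon>\<^sup>2 / (4 * (Im \<theta>)\<^sup>2))))) (at_right 0)"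
proof -
  interpret P: prob_space P by (rule prob_space_law)
  define \<sigma> where "\<sigma> = Im \<theta>"
  have \<sigma>: "0 < \<sigma>" using \<theta> by (simp add: \<sigma>_def)
  obtain a where U: "open U" "inj_on f U" "f holomorphic_on U"
    and a: "Im a \<le> 0" "closed_upper_half_plane - {a} \<subseteq> U"
    and lims: "((\<lambda>z. (z - a) * f z) \<longlongrightarrow> 0) (at a within U)"
      "((\<lambda>z. f z / complex_of_real (cmod z)) \<longlongrightarrow> 0) (inf at_infinity (principal U))"
    using adm unfolding admissible_generator_def by blast
  have \<theta>U: "\<theta> \<in> U" using a \<theta> by (auto simp: closed_upper_half_plane_altdef)
  have meas_f [measurable]: "(\<lambda>x. f (complex_of_real x)) \<in> borel_measurable borel"
    by (rule measurable_generator_on_reals[OF U(1) a(2) U(3)])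

  define W where "W = cauchy_direction \<theta>"
  have [measurable]: "W \<in> borel_measurable borel" unfolding W_def by measurable
  have nW: "norm (W x) = 1" for x unfolding W_def by (rule norm_cauchy_direction[OF \<theta>])
  define g where "g x = f (complex_of_real x) - f \<theta>" for x
  have [measurable]: "g \<in> borel_measurable borel" unfolding g_def[abs_def] by measurable

  \<comment> \<open>The factor \<open>q\<close> is lost three times: once in the rate for
    \<open>W\<close> and twice in the squared threshold \<open>c1 * \<epsilon>\<close>; Bernoulli's
    inequality gives \<open>q ^ 3 \<ge> 1 - \<eta>\<close>.\<close>
  define q where "q = 1 - \<eta> / 3"
  have q: "0 < q" "q < 1" using \<eta> by (auto simp: q_def)
  have q3: "1 - \<eta> \<le> q ^ 3"
    using Bernoulli_inequality[of "- \<eta> / 3" 3] \<eta> by (simp add: q_def)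

  have "\<exists>C\<ge>0. \<exists>r0>0. \<forall>r n. 0 < r \<and> r \<le> r0 \<longrightarrow>
      prob {\<omega> \<in> space M. norm (\<Sum>j=1..n. W (X j \<omega>)) \<ge> real n * r} \<le> C * exp (- real n * q * r\<^sup>2)"
  proof (rule moderate_deviation_complex[where s = 1 and v = "1 / 2"])
    show "(LINT x|P. W x) = 0"
      using mean_direction_power[OF \<theta>, of 1] by (simp add: W_def P)
    show "(LINT x|P. (Re (u * W x))\<^sup>2) \<le> 1 / 2" if "norm u = 1" for u
      using variance_direction[OF \<theta> that] by (simp only: W_def P)
  qed (use q nW in auto)
  then obtain C1 r1 where C1: "0 \<le> C1" "0 < r1" "\<And>r n. 0 < r \<Longrightarrow> r \<le> r1 \<Longrightarrow>
      prob {\<omega> \<in> space M. norm (\<Sum>j=1..n. W (X j \<omega>)) \<ge> real n * r} \<le> C1 * exp (- real n * q * r\<^sup>2)"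
    by blast

  \<comment> \<open>The mean of \<open>W\<^sup>2\<close> is multiplied by the small quantity
    \<open>cnj d\<close>, so the crude variance bound 1 and some positive rate are enough.\<close>
  have "\<exists>C\<ge>0. \<exists>r0>0. \<forall>r n. 0 < r \<and> r \<le> r0 \<longrightarrow>
      prob {\<omega> \<in> space M. norm (\<Sum>j=1..n. (W (X j \<omega>))\<^sup>2) \<ge> real n * r} \<le> C * exp (- real n * (1 / 4) * r\<^sup>2)"
  proof (rule moderate_deviation_complex[where s = 1 and v = 1])
    show "(LINT x|P. (W x)\<^sup>2) = 0"
      using mean_direction_power[OF \<theta>, of 2] by (simp add: W_def P)
    show "(LINT x|P. (Re (u * (W x)\<^sup>2))\<^sup>2) \<le> 1" if u: "norm u = 1" for u
    proof -
      have "(Re (u * (W x)\<^sup>2))\<^sup>2 \<le> 1" for x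
        using abs_Re_le_cmod[of "u * (W x)\<^sup>2"] u nW[of x] unfolding abs_square_le_1
        by (simp only: norm_mult norm_power) simp
      then have "(LINT x|P. (Re (u * (W x)\<^sup>2))\<^sup>2) \<le> (LINT x|P. 1)"
        by (intro integral_mono') auto
      then show ?thesis by (simp add: P.prob_space)
    qed
  qed (use nW in \<open>auto simp: norm_power\<close>)
  then obtain C2 r2 where C2: "0 \<le> C2" "0 < r2" "\<And>r n. 0 < r \<Longrightarrow> r \<le> r2 \<Longrightarrow>
      prob {\<omega> \<in> space M. norm (\<Sum>j=1..n. (W (X j \<omega>))\<^sup>2) \<ge> real n * r} \<le> C2 * exp (- real n * (1 / 4) * r\<^sup>2)"
    by blast

  have intf: "integrable P (\<lambda>x. exp (s * norm (f (complex_of_real x))))"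
    using int unfolding law[of 1, symmetric, simplified] by (subst integrable_distr_eq) auto
  have intg: "integrable P (\<lambda>x. exp (s * norm (g x)))"
  proof (rule Bochner_Integration.integrable_bound)
    show "integrable P (\<lambda>x. exp (s * norm (f \<theta>)) * exp (s * norm (f (complex_of_real x))))"
      using intf by simp
    have "s * norm (g x) \<le> s * (norm (f \<theta>) + norm (f (complex_of_real x)))" for x
      using s norm_triangle_ineq4[of "f (complex_of_real x)" "f \<theta>"]
      by (intro mult_left_mono) (auto simp: g_def add.commute)
    then show "AE x in P. norm (exp (s * norm (g x)))
        \<le> norm (exp (s * norm (f \<theta>)) * exp (s * norm (f (complex_of_real x))))"
      by (intro AE_I2) (simp add: distrib_left flip: exp_add)
  qed measurable
  have integrable_of_moment: "integrable P h" "integrable P (\<lambda>x. (norm (h x))\<^sup>2)"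
    if [measurable]: "h \<in> borel_measurable borel" and h: "integrable P (\<lambda>x. exp (s * norm (h x)))"
    for h :: "real \<Rightarrow> complex"
  proof -
    have "integrable P (\<lambda>x. norm (h x) ^ k)" for k
      by (rule integrable_power_of_exponential_moment[OF _ s]) (use h in auto)
    from this[of 1] this[of 2] show "integrable P h" "integrable P (\<lambda>x. (norm (h x))\<^sup>2)"
      by (auto intro: Bochner_Integration.integrable_bound[of P "\<lambda>x. norm (h x) ^ 1"])
  qed
  define v where "v = (LINT x|P. (norm (g x))\<^sup>2)"
  have v: "0 \<le> v" unfolding v_def by simp
  \<comment> \<open>Any positive rate will do for \<open>g\<close>; adding 1 to \<open>v\<close>
    covers \<open>v = 0\<close>.\<close>
  define \<rho> where "\<rho> = 1 / (4 * (v + 1))"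
  have \<rho>: "0 < \<rho>" "2 * v * \<rho> < 1" using v by (auto simp: \<rho>_def field_simps)
  have "\<exists>C\<ge>0. \<exists>r0>0. \<forall>r n. 0 < r \<and> r \<le> r0 \<longrightarrow>
      prob {\<omega> \<in> space M. norm (\<Sum>j=1..n. g (X j \<omega>)) \<ge> real n * r} \<le> C * exp (- real n * \<rho> * r\<^sup>2)"
  proof (rule moderate_deviation_complex[where s = s and v = v])
    have iF: "integrable P (\<lambda>x. f (complex_of_real x))"
      by (rule integrable_of_moment(1)[OF meas_f intf])
    then have "integrable lborel (\<lambda>x. cauchy_density \<theta> x *\<^sub>R f (complex_of_real x))"
      using integrable_cauchy_distribution[OF \<theta> meas_f] by (simp add: P)
    then have "(LINT x|P. f (complex_of_real x)) = f \<theta>"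
      using cauchy_mean_admissible[OF \<theta> a(1) U(1) a(2) U(3) lims]
        integral_cauchy_distribution[OF \<theta> meas_f] by (simp add: P)
    then show "(LINT x|P. g x) = 0"
      unfolding g_def using iF by (simp add: P.prob_space)
    show "(LINT x|P. (Re (u * g x))\<^sup>2) \<le> v" if u: "norm u = 1" for u
      unfolding v_def
    proof (rule integral_mono')
      show "integrable P (\<lambda>x. (norm (g x))\<^sup>2)" by (rule integrable_of_moment(2)[OF _ intg]) measurable
      show "(Re (u * g x))\<^sup>2 \<le> (norm (g x))\<^sup>2" for x
      proof -
        have "\<bar>Re (u * g x)\<bar> \<le> norm (g x)"
          using abs_Re_le_cmod[of "u * g x"] unfolding norm_mult u mult_1 .
        then show ?thesis using abs_le_square_iff[of "Re (u * g x)" "norm (g x)"] by simp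
      qed
    qed simp
  qed (use s \<rho> intg in auto)
  then obtain C3 r3 where C3: "0 \<le> C3" "0 < r3" "\<And>r n. 0 < r \<Longrightarrow> r \<le> r3 \<Longrightarrow>
      prob {\<omega> \<in> space M. norm (\<Sum>j=1..n. g (X j \<omega>)) \<ge> real n * r} \<le> C3 * exp (- real n * \<rho> * r\<^sup>2)"
    by blast

  obtain L \<rho>0 where L: "0 \<le> L" "0 < \<rho>0"
    "\<And>w. norm (w - f \<theta>) < \<rho>0 \<Longrightarrow> norm (inv_into U f w - \<theta>) \<le> L * norm (w - f \<theta>)"
    using inv_into_holomorphic_lipschitz[OF U \<theta>U] by blast

  \<comment> \<open>\<open>c1\<close> makes the leading term
    \<open>2 * \<sigma> * (c1 * \<epsilon>)\<close> equal to \<open>q * \<epsilon>\<close>;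
    \<open>c2\<close> and \<open>c3\<close> give their events exactly the exponent
    \<open>\<epsilon>\<^sup>2 / (4 * \<sigma>\<^sup>2)\<close> per observation.\<close>
  define c1 c2 c3 where "c1 = q / (2 * \<sigma>)" and "c2 = 1 / \<sigma>" and "c3 = 1 / (2 * \<sigma> * sqrt \<rho>)"
  have c: "0 < c1" "0 < c2" "0 < c3" using q \<sigma> \<rho> by (auto simp: c1_def c2_def c3_def)
  \<comment> \<open>The coefficient of \<open>\<epsilon>\<^sup>2\<close> in the error bound for
    \<open>\<delta> = L * c3 * \<epsilon>\<close>.\<close>
  define K where "K = L * c3 * q / \<sigma> + L * c3 * c2 + 8 * (L * c3)\<^sup>2 / \<sigma>"
  have tail: "\<exists>C\<ge>0. \<forall>n\<ge>1.
      prob {\<omega> \<in> space M. cmod (one_step_estimator U f n (\<lambda>j. X j \<omega>) - \<theta>) > \<epsilon>}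
        \<le> C * exp (- real n * ((1 - \<eta>) * (\<epsilon>\<^sup>2 / (4 * (Im \<theta>)\<^sup>2))))"
    if \<epsilon>: "0 < \<epsilon>" "c1 * \<epsilon> < r1" "c2 * \<epsilon> < r2" "c3 * \<epsilon> < r3" "c3 * \<epsilon> < \<rho>0"
      "L * c3 * \<epsilon> < \<sigma> / 2" "K * \<epsilon> < 1 - q" for \<epsilon>
  proof (intro exI[of _ "C1 + C2 + C3"] conjI allI impI)
    fix n :: nat assume n: "1 \<le> n"
    define A1 where "A1 = {\<omega> \<in> space M. norm (\<Sum>j=1..n. W (X j \<omega>)) \<ge> real n * (c1 * \<epsilon>)}"
    define A2 where "A2 = {\<omega> \<in> space M. norm (\<Sum>j=1..n. (W (X j \<omega>))\<^sup>2) \<ge> real n * (c2 * \<epsilon>)}"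
    define A3 where "A3 = {\<omega> \<in> space M. norm (\<Sum>j=1..n. g (X j \<omega>)) \<ge> real n * (c3 * \<epsilon>)}"
    have sum_meas [measurable]: "(\<lambda>\<omega>. \<Sum>j=1..n. h (X j \<omega>)) \<in> borel_measurable M"
      if "h \<in> borel_measurable borel" for h :: "real \<Rightarrow> complex"
      using that by (intro borel_measurable_sum measurable_compose[OF measurable_X]) auto
    have A: "A1 \<in> events" "A2 \<in> events" "A3 \<in> events"
      unfolding A1_def A2_def A3_def by measurable
    have "{\<omega> \<in> space M. cmod (one_step_estimator U f n (\<lambda>j. X j \<omega>) - \<theta>) > \<epsilon>} \<subseteq> A1 \<union> A2 \<union> A3"
    proof (rule subsetI, rule ccontr)
      fix \<omega> assume \<omega>: "\<omega> \<in> {\<omega> \<in> space M. cmod (one_step_estimator U f n (\<lambda>j. X j \<omega>) - \<theta>) > \<epsilon>}"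
        and "\<omega> \<notin> A1 \<union> A2 \<union> A3"
      then have S: "norm (\<Sum>j=1..n. W (X j \<omega>)) < real n * (c1 * \<epsilon>)"
        "norm (\<Sum>j=1..n. (W (X j \<omega>))\<^sup>2) < real n * (c2 * \<epsilon>)"
        "norm (\<Sum>j=1..n. g (X j \<omega>)) < real n * (c3 * \<epsilon>)"
        by (auto simp: A1_def A2_def A3_def)
      define m where "m = 1 / of_nat n * (\<Sum>j=1..n. f (complex_of_real (X j \<omega>)))"
      have "of_nat n * (m - f \<theta>) = (\<Sum>j=1..n. g (X j \<omega>))"
        using n by (simp add: m_def g_def sum_subtractf right_diff_distrib)
      then have "real n * norm (m - f \<theta>) < real n * (c3 * \<epsilon>)"
        using S(3) by (metis norm_mult norm_of_nat)
      then have m: "norm (m - f \<theta>) < c3 * \<epsilon>" using n by simp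
      have "norm (inv_into U f m - \<theta>) \<le> L * norm (m - f \<theta>)"
        using m \<epsilon> by (intro L(3)) simp
      also have "\<dots> \<le> L * (c3 * \<epsilon>)" using m L by (intro mult_left_mono) auto
      finally have "norm (quasi_arithmetic_mean U f n (\<lambda>j. X j \<omega>) - \<theta>) \<le> L * c3 * \<epsilon>"
        by (simp add: quasi_arithmetic_mean_def m_def)
      from one_step_estimator_error[OF \<theta> _ this, of "c1 * \<epsilon>" "c2 * \<epsilon>"]
      have "norm (one_step_estimator U f n (\<lambda>j. X j \<omega>) - \<theta>)
          \<le> (2 * \<sigma> + 2 * (L * c3 * \<epsilon>)) * (c1 * \<epsilon>) + L * c3 * \<epsilon> * (c2 * \<epsilon>) + 8 * (L * c3 * \<epsilon>)\<^sup>2 / \<sigma>"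
        using n S \<epsilon> by (simp add: W_def \<sigma>_def)
      also have "\<dots> = \<epsilon> * (q + K * \<epsilon>)"
        using \<sigma> by (simp add: K_def c1_def field_simps power2_eq_square)
      also have "\<dots> \<le> \<epsilon> * 1"
        using \<epsilon> by (intro mult_left_mono) auto
      finally show False using \<omega> by simp
    qed
    then have "prob {\<omega> \<in> space M. cmod (one_step_estimator U f n (\<lambda>j. X j \<omega>) - \<theta>) > \<epsilon>} \<le> prob (A1 \<union> A2 \<union> A3)"
      using A by (intro finite_measure_mono) auto
    also have "\<dots> \<le> prob A1 + prob A2 + prob A3"
      using A measure_Un_le[of "A1 \<union> A2" M A3] measure_Un_le[of A1 M A2] by auto
    also have "\<dots> \<le> C1 * exp (- (real n * q * (c1 * \<epsilon>)\<^sup>2)) + C2 * exp (- (real n * (1 / 4) * (c2 * \<epsilon>)\<^sup>2))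
        + C3 * exp (- (real n * \<rho> * (c3 * \<epsilon>)\<^sup>2))"
      unfolding A1_def A2_def A3_def
      using C1(3)[of "c1 * \<epsilon>" n] C2(3)[of "c2 * \<epsilon>" n] C3(3)[of "c3 * \<epsilon>" n] c \<epsilon>
      by (intro add_mono) auto
    also have "\<dots> \<le> (C1 + C2 + C3) * exp (- (real n * ((1 - \<eta>) * (\<epsilon>\<^sup>2 / (4 * \<sigma>\<^sup>2)))))"
    proof (rule three_exponentials_le)
      define \<beta> where "\<beta> = real n * (\<epsilon>\<^sup>2 / (4 * \<sigma>\<^sup>2))"
      have \<beta>: "0 \<le> \<beta>" by (simp add: \<beta>_def)
      have b: "real n * ((1 - \<eta>) * (\<epsilon>\<^sup>2 / (4 * \<sigma>\<^sup>2))) = (1 - \<eta>) * \<beta>" by (simp add: \<beta>_def)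
      have "real n * q * (c1 * \<epsilon>)\<^sup>2 = q ^ 3 * \<beta>"
        by (simp add: \<beta>_def c1_def power2_eq_square power3_eq_cube)
      then show "real n * ((1 - \<eta>) * (\<epsilon>\<^sup>2 / (4 * \<sigma>\<^sup>2))) \<le> real n * q * (c1 * \<epsilon>)\<^sup>2"
        using q3 \<beta> unfolding b by (simp add: mult_right_mono)
      have le: "(1 - \<eta>) * \<beta> \<le> \<beta>" using \<beta> \<eta> by (simp add: mult_left_le_one_le)
      have "real n * (1 / 4) * (c2 * \<epsilon>)\<^sup>2 = \<beta>"
        by (simp add: \<beta>_def c2_def power2_eq_square)
      then show "real n * ((1 - \<eta>) * (\<epsilon>\<^sup>2 / (4 * \<sigma>\<^sup>2))) \<le> real n * (1 / 4) * (c2 * \<epsilon>)\<^sup>2"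
        using le unfolding b by simp
      have "real n * \<rho> * (c3 * \<epsilon>)\<^sup>2 = \<beta>"
        using \<rho> by (simp add: \<beta>_def c3_def power_mult_distrib power_divide)
      then show "real n * ((1 - \<eta>) * (\<epsilon>\<^sup>2 / (4 * \<sigma>\<^sup>2))) \<le> real n * \<rho> * (c3 * \<epsilon>)\<^sup>2"
        using le unfolding b by simp
    qed (use C1 C2 C3 in auto)
    finally show "prob {\<omega> \<in> space M. cmod (one_step_estimator U f n (\<lambda>j. X j \<omega>) - \<theta>) > \<epsilon>}
        \<le> (C1 + C2 + C3) * exp (- real n * ((1 - \<eta>) * (\<epsilon>\<^sup>2 / (4 * (Im \<theta>)\<^sup>2))))"
      by (simp add: \<sigma>_def)
  qed (use C1 C2 C3 in auto)
  have "eventually (\<lambda>\<epsilon>::real. 0 < \<epsilon>) (at_right 0)" by (rule eventually_at_right_less)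
  moreover have "0 < \<sigma> / 2" "0 < 1 - q" using \<sigma> q by auto
  note eventually_mult_less_at_right_0[OF C1(2), of c1] eventually_mult_less_at_right_0[OF C2(2), of c2]
    eventually_mult_less_at_right_0[OF C3(2), of c3] eventually_mult_less_at_right_0[OF L(2), of c3]
    eventually_mult_less_at_right_0[OF this(1), of "L * c3"] eventually_mult_less_at_right_0[OF this(2), of K]
  ultimately show ?thesis
    by eventually_elim (rule tail)
qed

end

section \<open>Passage to the two upper limits\<close>

theorem theorem4p1:
  fixes M :: "'a measure"
    and X :: "nat \<Rightarrow> 'a \<Rightarrow> real"
    and \<theta> :: complex
    and U :: "complex set"
    and f :: "complex \<Rightarrow> complex"
  assumes "prob_space M"
    and "\<theta> \<in> upper_half_plane"
    and "prob_space.indep_vars M (\<lambda>_. borel) X {1..}"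
    and "\<And>j. j \<ge> 1 \<Longrightarrow> distributed M lborel (X j) (cauchy_density \<theta>)"
    and "admissible_generator U f"
    and "\<exists>t>0. integrable M (\<lambda>\<omega>. exp (t * cmod (f (complex_of_real (X 1 \<omega>)))))"
  shows "Limsup (at_right 0) (\<lambda>\<epsilon>. limsup (\<lambda>n.
           ereal_ln (measure M {\<omega> \<in> space M.
             cmod (one_step_estimator U f n (\<lambda>j. X j \<omega>) - \<theta>) > \<epsilon>})
           / ereal (real n * bahadur_bound \<epsilon> \<theta>))) \<le> - 1"
proof (rule ereal_le_epsilon2)
  fix e :: real assume e: "0 < e"
  \<comment> \<open>One \<open>\<eta>\<close> is lost in the tail estimate and another in absorbing
    its prefactor, hence \<open>2 * \<eta> \<le> e\<close>; the cap \<open>1 / 3\<close> keeps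
    \<open>1 - 2 * \<eta>\<close> positive.\<close>
  define \<eta> where "\<eta> = min (e / 2) (1 / 3)"
  have \<eta>: "0 < \<eta>" "\<eta> < 1" "2 * \<eta> \<le> e" "2 * \<eta> < 1" using e by (auto simp: \<eta>_def)
  have \<sigma>: "0 < Im \<theta>" using assms(2) by (simp add: upper_half_plane_def)
  interpret prob_space M by fact
  interpret iid_sample M X "cauchy_distribution \<theta>"
    by (rule iid_sample_cauchy[OF assms(3,4)])
  obtain s where s: "0 < s" "integrable M (\<lambda>\<omega>. exp (s * cmod (f (complex_of_real (X 1 \<omega>)))))"
    using assms(6) by blast
  define Q where "Q \<epsilon> n = prob {\<omega> \<in> space M. cmod (one_step_estimator U f n (\<lambda>j. X j \<omega>) - \<theta>) > \<epsilon>}" for \<epsilon> n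
  have "eventually (\<lambda>\<epsilon>. \<exists>C\<ge>0. \<forall>n\<ge>1. Q \<epsilon> n \<le> C * exp (- real n * ((1 - \<eta>) * (\<epsilon>\<^sup>2 / (4 * (Im \<theta>)\<^sup>2))))) (at_right 0)"
    unfolding Q_def by (rule one_step_estimator_tail[OF \<sigma> refl assms(5) s \<eta>(1,2)])
  moreover have "eventually (\<lambda>\<epsilon>. \<epsilon> \<in> {0<..<Im \<theta> / 2}) (at_right 0)"
    using \<sigma> by (intro eventually_at_right_real) simp
  ultimately have "eventually (\<lambda>\<epsilon>. limsup (\<lambda>n. ereal_ln (Q \<epsilon> n) / ereal (real n * bahadur_bound \<epsilon> \<theta>)) \<le> ereal (- 1 + e)) (at_right 0)"
  proof eventually_elim
    case (elim \<epsilon>)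
    then obtain C where C: "0 \<le> C" "\<And>n. 1 \<le> n \<Longrightarrow> Q \<epsilon> n \<le> C * exp (- real n * ((1 - \<eta>) * (\<epsilon>\<^sup>2 / (4 * (Im \<theta>)\<^sup>2))))"
      by blast
    define \<beta> where "\<beta> = \<epsilon>\<^sup>2 / (4 * (Im \<theta>)\<^sup>2)"
    have \<beta>: "0 < \<beta>" using elim \<sigma> by (simp add: \<beta>_def)
    have b: "0 \<le> bahadur_bound \<epsilon> \<theta>" "bahadur_bound \<epsilon> \<theta> \<le> \<beta>"
      using bahadur_bound_bounds[OF \<sigma>, of \<epsilon>] elim by (auto simp: \<beta>_def)
    define c where "c = \<eta> * \<beta>"
    have c: "0 < c" using \<eta> \<beta> by (simp add: c_def)
    \<comment> \<open>The prefactor \<open>C\<close> may depend on \<open>\<epsilon>\<close> but not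
      on \<open>n\<close>, so a fraction \<open>\<eta>\<close> of the exponent eventually outweighs
      it.\<close>
    have "eventually (\<lambda>n. C * exp (- real n * c) < 1) sequentially"
    proof (rule order_tendstoD(2))
      show "(\<lambda>n. C * exp (- real n * c)) \<longlonglongrightarrow> 0"
        using c by real_asymp
    qed simp
    then have "eventually (\<lambda>n. ereal_ln (Q \<epsilon> n) / ereal (real n * bahadur_bound \<epsilon> \<theta>) \<le> ereal (- 1 + e)) sequentially"
      using eventually_gt_at_top[of 0]
    proof eventually_elim
      fix n :: nat assume n: "C * exp (- real n * c) < 1" "0 < n"
      have "Q \<epsilon> n \<le> C * exp (- real n * ((1 - \<eta>) * \<beta>))"
        using C(2)[of n] n by (simp add: \<beta>_def)
      also have "\<dots> = C * exp (- real n * c) * exp (- (real n * ((1 - 2 * \<eta>) * \<beta>)))"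
        by (simp add: c_def algebra_simps flip: exp_add)
      also have "\<dots> \<le> 1 * exp (- (real n * ((1 - 2 * \<eta>) * \<beta>)))"
        using n by (intro mult_right_mono) auto
      finally have Q: "Q \<epsilon> n \<le> exp (- (real n * ((1 - 2 * \<eta>) * \<beta>)))" by simp
      show "ereal_ln (Q \<epsilon> n) / ereal (real n * bahadur_bound \<epsilon> \<theta>) \<le> ereal (- 1 + e)"
      \<comment> \<open>Replacing \<open>bahadur_bound \<epsilon> \<theta>\<close> by its upper
        bound \<open>\<beta>\<close> turns the quotient into
        \<open>- (1 - 2 * \<eta>)\<close>.\<close>
      proof (rule order_trans[OF ereal_ln_divide_le[OF _ Q, where B' = "real n * \<beta>"]])
        have "- (real n * ((1 - 2 * \<eta>) * \<beta>)) / (real n * \<beta>) = - (1 - 2 * \<eta>)"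
          using n \<beta> by simp
        then show "ereal (- (real n * ((1 - 2 * \<eta>) * \<beta>)) / (real n * \<beta>)) \<le> ereal (- 1 + e)"
          using \<eta> by simp
      qed (use n \<beta> \<eta> b in \<open>auto simp: Q_def mult_left_mono\<close>)
    qed
    then show ?case by (rule Limsup_bounded)
  qed
  then have "Limsup (at_right 0) (\<lambda>\<epsilon>. limsup (\<lambda>n. ereal_ln (Q \<epsilon> n) / ereal (real n * bahadur_bound \<epsilon> \<theta>))) \<le> ereal (- 1 + e)"
    by (rule Limsup_bounded)
  then show "Limsup (at_right 0) (\<lambda>\<epsilon>. limsup (\<lambda>n.
      ereal_ln (prob {\<omega> \<in> space M. cmod (one_step_estimator U f n (\<lambda>j. X j \<omega>) - \<theta>) > \<epsilon>})
      / ereal (real n * bahadur_bound \<epsilon> \<theta>))) \<le> - 1 + ereal e"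
    unfolding Q_def by (simp add: one_ereal_def)
qed

end
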